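(* Let $n\in\mathbb{N}$, $0<\alpha<n$ and $0<\beta\le n$. Suppose that $f\in L^{n/\alpha,\infty}(\mathbb{R}^n)$ and $I_\alpha f\in L^1_{loc}(\mathbb{R}^n)$. Then there exists a constant $C=C(n,\alpha,\beta)$ such that $$\|I_\alpha f\|_{BMO^\beta(\mathbb{R}^n)}\le C\|f\|_{L^{n/\alpha,\infty}(\mathbb{R}^n)}$$ (in particular $I_\alpha f\in BMO^\beta(\mathbb{R}^n)$). In particular, there exist constants $\gamma,C_0>0$, independent of $f$, such that for every cube $Q\subseteq\mathbb{R}^n$ there is $c_Q\in\mathbb{R}$ (depending on $Q$) with $$\int_Q\exp\left(\frac{\gamma\,|I_\alpha f-c_Q|}{\|f\|_{L^{n/\alpha,\infty}(\mathbb{R}^n)}}\right)d\mathcal{H}^\beta_\infty\le C_0\,\ell(Q)^\beta$$ (for $f$ not almost everywhere zero).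
   Context: Riesz potential: $I_\alpha f(x)=\frac{1}{\gamma(\alpha)}\int_{\mathbb{R}^n}\frac{f(y)}{|x-y|^{n-\alpha}}\,dy$, with $\gamma(\alpha)>0$ the usual normalization constant; $I_\alpha f\in L^1_{loc}(\mathbb{R}^n)$ includes that the integral converges absolutely for a.e. $x$. $L^{q,\infty}(\mathbb{R}^n)$ is the usual weak Lebesgue space, with quasi-norm $\sup_{\lambda>0}\lambda\,|\{|f|>\lambda\}|^{1/q}$. For $0<\beta\le n$, the Hausdorff content of $E\subseteq\mathbb{R}^n$ is $\mathcal{H}^\beta_\infty(E)=\inf\{\sum_{i}\omega_\beta r_i^\beta: E\subset\bigcup_{i=1}^\infty B(x_i,r_i)\}$, $\omega_\beta=\pi^{\beta/2}/\Gamma(\beta/2+1)$. For non-negative $g$, the Choquet integral is $\int_\Omega g\,d\mathcal{H}^\beta_\infty=\int_0^\infty\mathcal{H}^\beta_\infty(\{x\in\Omega:g(x)>t\})\,dt$. Here $\Omega$ is $\mathbb{R}^n$ or an open cube; $\ell(Q)$ is the side length of a cube $Q$. A function $g$ on $\Omega$ is $\mathcal{H}^\beta_\infty$-quasicontinuous if for every $\epsilon>0$ there is an open set $O\subseteq\Omega$ with $\mathcal{H}^\beta_\infty(O)<\epsilon$ such that $g$ restricted to $\Omega\setminus O$ is continuous; functions need only be defined and finite outside a set of zero $\mathcal{H}^\beta_\infty$ content. $L^1(\Omega;\mathcal{H}^\beta_\infty)$ is the set of $\mathcal{H}^\beta_\infty$-quasicontinuous $g$ with $\int_\Omega|g|\,d\mathcal{H}^\beta_\infty<\infty$,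 and $g\in L^1_{loc}(\mathbb{R}^n;\mathcal{H}^\beta_\infty)$ means $g|_Q\in L^1(Q;\mathcal{H}^\beta_\infty)$ for every (finite, open) cube $Q$. $BMO^\beta(\mathbb{R}^n)$ is the set of $u\in L^1_{loc}(\mathbb{R}^n;\mathcal{H}^\beta_\infty)$ with $$\|u\|_{BMO^\beta(\mathbb{R}^n)}:=\sup_{Q\subseteq\mathbb{R}^n}\inf_{c\in\mathbb{R}}\frac{1}{\ell(Q)^\beta}\int_Q|u-c|\,d\mathcal{H}^\beta_\infty<\infty,$$ the supremum being over all finite cubes $Q$. *)

theory Defs
  imports "HOL-Analysis.Analysis"
begin

text \<open>Powers of extended nonnegative reals; used only for exponents \<open>p > 0\<close>.\<close>

definition ennreal_powr :: "ennreal \<Rightarrow> real \<Rightarrow> ennreal" where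
  "ennreal_powr x p = (if x = \<infinity> then \<infinity> else ennreal (enn2real x powr p))"

definition weak_Lp_norm :: "real \<Rightarrow> ('a::euclidean_space \<Rightarrow> real) \<Rightarrow> ennreal" where
  "weak_Lp_norm q f =
     (SUP s\<in>{0<..}. ennreal s * ennreal_powr (emeasure lebesgue {x. \<bar>f x\<bar> > s}) (1 / q))"

definition weak_Lp :: "real \<Rightarrow> ('a::euclidean_space \<Rightarrow> real) set" where
  "weak_Lp q = {f \<in> borel_measurable lebesgue. weak_Lp_norm q f < \<infinity>}"


definition riesz_gamma :: "real \<Rightarrow> real \<Rightarrow> real" where
  "riesz_gamma n \<alpha> = pi powr (n / 2) * 2 powr \<alpha> * Gamma (\<alpha> / 2) / Gamma ((n - \<alpha>) / 2)"

definition riesz_integrand :: "real \<Rightarrow> ('a::euclidean_space \<Rightarrow> real) \<Rightarrow> 'a \<Rightarrow> 'a \<Rightarrow> real" where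
  "riesz_integrand \<alpha> f x y = f y / norm (x - y) powr (real DIM('a) - \<alpha>)"

definition riesz_converges :: "real \<Rightarrow> ('a::euclidean_space \<Rightarrow> real) \<Rightarrow> 'a \<Rightarrow> bool" where
  "riesz_converges \<alpha> f x \<longleftrightarrow> integrable lebesgue (riesz_integrand \<alpha> f x)"

text \<open>The Bochner integral is \<open>0\<close> where it does not converge absolutely, so
  the Riesz potential below is a total function that carries its mathematical meaning
  only at the points satisfying \<open>riesz_converges\<close>.\<close>

definition riesz_potential :: "real \<Rightarrow> ('a::euclidean_space \<Rightarrow> real) \<Rightarrow> 'a \<Rightarrow> real" where
  "riesz_potential \<alpha> f x =
     (1 / riesz_gamma (real DIM('a)) \<alpha>) * integral\<^sup>L lebesgue (riesz_integrand \<alpha> f x)"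

definition riesz_potential_L1_loc :: "real \<Rightarrow> ('a::euclidean_space \<Rightarrow> real) \<Rightarrow> bool" where
  "riesz_potential_L1_loc \<alpha> f \<longleftrightarrow>
     (AE x in lebesgue. riesz_converges \<alpha> f x) \<and>
     (\<forall>K. compact K \<longrightarrow> set_integrable lebesgue K (riesz_potential \<alpha> f))"


text \<open>\<open>unit_ball_vol \<beta>\<close> is \<open>\<pi>\<close> to the power \<open>\<beta> / 2\<close> divided by \<open>\<Gamma>(\<beta> / 2 + 1)\<close>, for real \<open>\<beta>\<close>.
  A ball of radius \<open>0\<close> is empty and contributes \<open>0\<close> to the sum, so finite covers are included.\<close>

definition hausdorff_content :: "real \<Rightarrow> 'a::euclidean_space set \<Rightarrow> ennreal" where
  "hausdorff_content \<beta> E =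
     Inf {(\<Sum>i. ennreal (unit_ball_vol \<beta> * r i powr \<beta>)) | (c :: nat \<Rightarrow> 'a) (r :: nat \<Rightarrow> real).
            (\<forall>i. r i \<ge> 0) \<and> E \<subseteq> (\<Union>i. ball (c i) (r i))}"

definition choquet_integral ::
    "real \<Rightarrow> 'a::euclidean_space set \<Rightarrow> ('a \<Rightarrow> real) \<Rightarrow> ennreal" where
  "choquet_integral \<beta> \<Omega> g = (\<integral>\<^sup>+t\<in>{0<..}. hausdorff_content \<beta> {x \<in> \<Omega>. g x > t} \<partial>lborel)"

definition quasicontinuous_on ::
    "real \<Rightarrow> 'a::euclidean_space set \<Rightarrow> ('a \<Rightarrow> real) \<Rightarrow> bool" where
  "quasicontinuous_on \<beta> \<Omega> g \<longleftrightarrow>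
     (\<forall>\<epsilon>>0. \<exists>U. open U \<and> U \<subseteq> \<Omega> \<and> hausdorff_content \<beta> U < ennreal \<epsilon> \<and> continuous_on (\<Omega> - U) g)"

text \<open>The functions here are total. A function that is defined only outside a set of
  content zero is extended to that set by arbitrary values: neither quasicontinuity on an
  open set nor the Choquet integral depends on the extension.\<close>

definition content_L1 :: "real \<Rightarrow> 'a::euclidean_space set \<Rightarrow> ('a \<Rightarrow> real) set" where
  "content_L1 \<beta> \<Omega> =
     {g. quasicontinuous_on \<beta> \<Omega> g \<and> choquet_integral \<beta> \<Omega> (\<lambda>x. \<bar>g x\<bar>) < \<infinity>}"

definition cube :: "'a::euclidean_space \<Rightarrow> real \<Rightarrow> 'a set" where
  "cube a l = box a (a + l *\<^sub>R One)"

definition content_L1_loc :: "real \<Rightarrow> ('a::euclidean_space \<Rightarrow> real) set" where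
  "content_L1_loc \<beta> = {g. \<forall>a l. l > 0 \<longrightarrow> g \<in> content_L1 \<beta> (cube a l)}"

definition BMO_norm :: "real \<Rightarrow> ('a::euclidean_space \<Rightarrow> real) \<Rightarrow> ennreal" where
  "BMO_norm \<beta> u =
     (SUP (a, l) \<in> UNIV \<times> {0<..}. INF c.
        ennreal (1 / l powr \<beta>) * choquet_integral \<beta> (cube a l) (\<lambda>x. \<bar>u x - c\<bar>))"

definition BMO :: "real \<Rightarrow> ('a::euclidean_space \<Rightarrow> real) set" where
  "BMO \<beta> = {u \<in> content_L1_loc \<beta>. BMO_norm \<beta> u < \<infinity>}"

end

theory Submission
  imports Defs
begin

text \<open>Let \<open>f\<close> belong to weak \<open>L\<close>-\<open>(n/\<alpha>)\<close> with constant \<open>A\<close>, and write \<open>k = n - \<alpha>\<close> for the order of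
  the Riesz kernel. Everything follows from one tail estimate: on a cube of side \<open>l\<close> the
  potential deviates from a suitable constant by more than \<open>t\<close> only on a set of content at
  most a constant times \<open>l\<^sup>\<beta> exp (- c t / A)\<close>.

  The tail estimate is obtained by cutting \<open>f\<close> at a ball of radius \<open>R\<close> comparable to \<open>l\<close>.
  Kolmogorov's inequality (lemma \<open>kolmogorov_ball\<close>) says that a ball of radius \<open>r\<close> carries
  mass \<open>\<integral>|f| \<le> C A r\<^sup>k\<close>. Hence the part of \<open>f\<close> outside the ball, as soon as its potential
  converges at one point, produces a potential that is Lipschitz on the cube with constant of
  order \<open>A / R\<close>, so that it oscillates there by at most a multiple of \<open>A\<close> (lemma
  \<open>far_potential_lipschitz\<close>). For the part inside the ball, the same inequality bounds the
  contribution of every dyadic shell around \<open>x\<close> by a multiple of \<open>A\<close>, so the first \<open>N\<close> shells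
  cost \<open>C A N\<close>. The inner shells are controlled only away from a small set. Since \<open>\<beta> > 0\<close>,
  there is an exponent \<open>p \<ge> 1\<close> with \<open>n - \<beta> < \<alpha> p < n\<close>. Then \<open>|f|\<^sup>p\<close> is still integrable on the
  ball, and the points \<open>x\<close> that have some ball with \<open>\<integral>|f|\<^sup>p > s r\<^sup>\<beta>\<close> form an open set whose
  content is at most a multiple of the total mass divided by \<open>s\<close>, by the Vitali covering lemma
  (\<open>content_maximal_weak_type\<close>). Off this set the mass \<open>\<integral>|f|\<close> of balls around \<open>x\<close> gains a
  factor \<open>r\<^sup>\<kappa>\<close> over \<open>r\<^sup>k\<close>, where \<open>\<kappa> = (\<alpha> p - n + \<beta>) / p > 0\<close>, and the inner shells form a
  geometric series of ratio \<open>2\<close> to the power \<open>-\<kappa>\<close>. Letting \<open>s\<close> grow like \<open>2\<close> to the power \<open>N \<kappa>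
  p\<close> keeps the inner shells below \<open>C A\<close> and makes the content of the exceptional set decay
  exponentially in \<open>N\<close>.

  The same decomposition gives the remaining claims. The integral diverges at most on the
  intersection of the exceptional sets, which has content zero. Off an exceptional set with
  fixed \<open>s\<close> the truncated potentials, which are Lipschitz, converge uniformly, so the
  potential is continuous there; as exceptional sets are open and of arbitrarily small
  content, it is quasicontinuous. Integrating the tail estimate in \<open>t\<close> yields the bounds on
  both Choquet integrals.\<close>


section \<open>Hausdorff content\<close>

lemma hausdorff_content_le_cover:
  assumes "\<And>i. r i \<ge> 0" and "E \<subseteq> (\<Union>i. ball (c i) (r i))"
  shows "hausdorff_content \<beta> E \<le> (\<Sum>i. ennreal (unit_ball_vol \<beta> * r i powr \<beta>))"
  unfolding hausdorff_content_def using assms by (intro Inf_lower) auto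

lemma hausdorff_content_mono: "E \<subseteq> F \<Longrightarrow> hausdorff_content \<beta> E \<le> hausdorff_content \<beta> F"
  unfolding hausdorff_content_def by (intro Inf_superset_mono) blast

lemma hausdorff_content_ball:
  fixes c :: "'a::euclidean_space"
  assumes "r \<ge> 0"
  shows "hausdorff_content \<beta> (ball c r) \<le> ennreal (unit_ball_vol \<beta> * r powr \<beta>)"
proof -
  \<comment> \<open>Balls of radius \<open>0\<close> are empty and fill up the sequence.\<close>
  let ?r = "\<lambda>i::nat. if i = 0 then r else 0"
  have "hausdorff_content \<beta> (ball c r) \<le> (\<Sum>i. ennreal (unit_ball_vol \<beta> * ?r i powr \<beta>))"
    by (rule hausdorff_content_le_cover[where c = "\<lambda>_. c"]) (use assms in auto)
  also have "\<dots> = (\<Sum>i\<in>{0}. ennreal (unit_ball_vol \<beta> * ?r i powr \<beta>))"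
    by (rule suminf_finite) auto
  finally show ?thesis by simp
qed

lemma hausdorff_content_empty [simp]: "hausdorff_content \<beta> ({} :: 'a::euclidean_space set) = 0"
  using hausdorff_content_ball[of 0 \<beta> "0 :: 'a"] by simp

text \<open>Covers of the single sets that are optimal up to \<open>e / 2\<close> to the power \<open>i + 1\<close> are merged
  into one sequence of balls along the enumeration of pairs.\<close>

lemma hausdorff_content_UN_nat:
  fixes E :: "nat \<Rightarrow> 'a::euclidean_space set"
  shows "hausdorff_content \<beta> (\<Union>i. E i) \<le> (\<Sum>i. hausdorff_content \<beta> (E i))"
proof (rule ennreal_le_epsilon)
  fix e :: real
  assume fin: "(\<Sum>i. hausdorff_content \<beta> (E i)) < top" and e: "0 < e"
  have lt: "hausdorff_content \<beta> (E i) < hausdorff_content \<beta> (E i) + ennreal (e * (1/2) ^ Suc i)" for i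
  proof -
    have "hausdorff_content \<beta> (E i) \<noteq> top"
      using ennreal_suminf_lessD[OF fin, of i] by (simp add: less_top)
    then show ?thesis using e by (simp add: less_top)
  qed
  define P where "P i c r \<longleftrightarrow> (\<forall>j. r j \<ge> 0) \<and> E i \<subseteq> (\<Union>j::nat. ball (c j) (r j)) \<and>
      (\<Sum>j. ennreal (unit_ball_vol \<beta> * r j powr \<beta>)) \<le> hausdorff_content \<beta> (E i) + ennreal (e * (1/2) ^ Suc i)"
    for i c r
  have "\<exists>c r. P i c r" for i
  proof -
    have "Inf {(\<Sum>i. ennreal (unit_ball_vol \<beta> * r i powr \<beta>)) | (c :: nat \<Rightarrow> 'a) (r :: nat \<Rightarrow> real).
            (\<forall>i. r i \<ge> 0) \<and> E i \<subseteq> (\<Union>i. ball (c i) (r i))}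
        < hausdorff_content \<beta> (E i) + ennreal (e * (1/2) ^ Suc i)"
      using lt[of i] by (simp add: hausdorff_content_def)
    then show ?thesis unfolding Inf_less_iff P_def by (auto intro: less_imp_le)
  qed
  then obtain c r where "\<And>i. P i (c i) (r i)" by metis
  then have cr: "\<And>i j. r i j \<ge> 0" "\<And>i. E i \<subseteq> (\<Union>j::nat. ball (c i j) (r i j))"
    "\<And>i. (\<Sum>j. ennreal (unit_ball_vol \<beta> * r i j powr \<beta>)) \<le> hausdorff_content \<beta> (E i) + ennreal (e * (1/2) ^ Suc i)"
    by (auto simp: P_def)
  let ?h = "\<lambda>(i, j). ennreal (unit_ball_vol \<beta> * r i j powr \<beta>)"
  have "(\<Union>i. E i) \<subseteq> (\<Union>m. ball (case_prod c (prod_decode m)) (case_prod r (prod_decode m)))"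
  proof
    fix x assume "x \<in> (\<Union>i. E i)"
    then obtain i j where "x \<in> ball (c i j) (r i j)" using cr(2) by blast
    then show "x \<in> (\<Union>m. ball (case_prod c (prod_decode m)) (case_prod r (prod_decode m)))"
      by (intro UN_I[of "prod_encode (i, j)"]) auto
  qed
  then have "hausdorff_content \<beta> (\<Union>i. E i) \<le>
      (\<Sum>m. ennreal (unit_ball_vol \<beta> * case_prod r (prod_decode m) powr \<beta>))"
    by (intro hausdorff_content_le_cover) (auto simp: cr split: prod.split)
  also have "\<dots> = (\<Sum>m. ?h (prod_decode m))"
    by (intro suminf_cong) (auto split: prod.split)
  also have "\<dots> = (\<Sum>i. \<Sum>j. ?h (i, j))"
    by (rule suminf_ennreal_2dimen) auto
  also have "\<dots> \<le> (\<Sum>i. hausdorff_content \<beta> (E i) + ennreal (e * (1/2) ^ Suc i))"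
    using cr(3) by (intro suminf_le) auto
  also have "\<dots> = (\<Sum>i. hausdorff_content \<beta> (E i)) + (\<Sum>i. ennreal (e * (1/2) ^ Suc i))"
    by (rule suminf_add[symmetric]) auto
  also have "(\<Sum>i. ennreal (e * (1/2) ^ Suc i)) = ennreal e"
    using sums_mult[OF power_half_series, of e] e
    by (intro sums_unique[symmetric] sums_ennreal[THEN iffD2]) auto
  finally show "hausdorff_content \<beta> (\<Union>i. E i) \<le> (\<Sum>i. hausdorff_content \<beta> (E i)) + ennreal e" .
qed

lemma hausdorff_content_UN_countable:
  fixes E :: "'i \<Rightarrow> 'a::euclidean_space set"
  assumes "countable I"
  shows "hausdorff_content \<beta> (\<Union>i\<in>I. E i) \<le> (\<integral>\<^sup>+i. hausdorff_content \<beta> (E i) \<partial>count_space I)"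
proof -
  let ?F = "\<lambda>m. if m \<in> to_nat_on I ` I then E (from_nat_into I m) else {}"
  have "hausdorff_content \<beta> (\<Union>i\<in>I. E i) \<le> hausdorff_content \<beta> (\<Union>m. ?F m)"
  proof (rule hausdorff_content_mono, safe)
    fix x i assume "i \<in> I" "x \<in> E i"
    then show "x \<in> (\<Union>m. ?F m)" using assms by (intro UN_I[of "to_nat_on I i"]) auto
  qed
  also have "\<dots> \<le> (\<Sum>m. hausdorff_content \<beta> (?F m))" by (rule hausdorff_content_UN_nat)
  also have "\<dots> = (\<integral>\<^sup>+m. hausdorff_content \<beta> (?F m) \<partial>count_space UNIV)"
    by (rule nn_integral_count_space_nat[symmetric])
  also have "\<dots> = (\<integral>\<^sup>+m. hausdorff_content \<beta> (E (from_nat_into I m)) \<partial>count_space (to_nat_on I ` I))"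
    by (subst (2) nn_integral_count_space_indicator) (auto intro!: nn_integral_cong simp: indicator_def)
  also have "\<dots> = (\<integral>\<^sup>+i. hausdorff_content \<beta> (E (from_nat_into I (to_nat_on I i))) \<partial>count_space I)"
    by (rule nn_integral_bij_count_space[symmetric])
       (rule inj_on_imp_bij_betw[OF inj_on_to_nat_on[OF assms]])
  also have "\<dots> = (\<integral>\<^sup>+i. hausdorff_content \<beta> (E i) \<partial>count_space I)"
    using assms by (intro nn_integral_cong) auto
  finally show ?thesis .
qed

text \<open>The mass of an open ball is the supremum of the masses of the concentric balls of slightly
  smaller radius, and such a smaller ball still fits into balls of the original radius around
  nearby points.\<close>

lemma open_maximal_set:
  fixes g :: "'a::euclidean_space \<Rightarrow> ennreal"
  assumes [measurable]: "g \<in> borel_measurable lebesgue"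
  shows "open {x. \<exists>r>0. ennreal (s * r powr \<beta>) < (\<integral>\<^sup>+y. g y * indicator (ball x r) y \<partial>lebesgue)}"
proof -
  define \<mu> where "\<mu> = density lebesgue g"
  have \<mu>: "emeasure \<mu> (ball x r) = (\<integral>\<^sup>+y. g y * indicator (ball x r) y \<partial>lebesgue)" for x r
    unfolding \<mu>_def by (subst emeasure_density) auto
  have "\<exists>e>0. ball x e \<subseteq> {x. \<exists>r>0. ennreal (s * r powr \<beta>) < emeasure \<mu> (ball x r)}"
    if r: "r > 0" and lt: "ennreal (s * r powr \<beta>) < emeasure \<mu> (ball x r)" for x r
  proof -
    define B where "B = (\<lambda>i. ball x (r - inverse (Suc i)))"
    have "(\<Union>i. B i) = ball x r"
    proof (intro equalityI subsetI)
      fix y assume "y \<in> ball x r"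
      then have "0 < r - dist x y" by auto
      then obtain i where "inverse (Suc i) < r - dist x y" using reals_Archimedean by blast
      then show "y \<in> (\<Union>i. B i)" unfolding B_def by (intro UN_I[of i]) auto
    next
      fix y assume "y \<in> (\<Union>i. B i)"
      then obtain i where "dist x y < r - inverse (Suc i)" by (auto simp: B_def)
      moreover have "inverse (real (Suc i)) > 0" by simp
      ultimately have "dist x y < r" by linarith
      then show "y \<in> ball x r" by simp
    qed
    moreover have "(SUP i. emeasure \<mu> (B i)) = emeasure \<mu> (\<Union>i. B i)"
    proof (rule SUP_emeasure_incseq)
      show "range B \<subseteq> sets \<mu>" unfolding B_def \<mu>_def by auto
      show "incseq B" unfolding B_def incseq_def
        by (intro allI impI subset_ball) (simp add: le_imp_inverse_le)
    qed
    ultimately obtain i where i: "ennreal (s * r powr \<beta>) < emeasure \<mu> (B i)"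
      using lt by (metis less_SUP_iff)
    have "ball x (inverse (Suc i)) \<subseteq> {x. \<exists>r>0. ennreal (s * r powr \<beta>) < emeasure \<mu> (ball x r)}"
    proof
      fix z assume z: "z \<in> ball x (inverse (Suc i))"
      have "B i \<subseteq> ball z r"
      proof
        fix y assume "y \<in> B i"
        then show "y \<in> ball z r"
          using z dist_triangle[of z y x] by (auto simp: B_def dist_commute)
      qed
      then have "emeasure \<mu> (B i) \<le> emeasure \<mu> (ball z r)"
        by (intro emeasure_mono) (auto simp: \<mu>_def)
      then show "z \<in> {x. \<exists>r>0. ennreal (s * r powr \<beta>) < emeasure \<mu> (ball x r)}"
        using i r by (auto intro: less_le_trans)
    qed
    then show ?thesis by (intro exI[of _ "inverse (Suc i)"]) auto
  qed
  then show ?thesis unfolding open_contains_ball by (auto simp flip: \<mu>)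
qed

text \<open>The weak-type bound for the maximal function of dimension \<open>\<beta>\<close>. Each point of the set has a
  ball whose mass exceeds \<open>s r\<^sup>\<beta>\<close>; finiteness of the total mass bounds these radii, so the
  Vitali covering lemma selects disjoint balls whose fivefold enlargements cover. The content
  of the cover is then paid for by the masses of the disjoint balls. The factor is \<open>6\<close> instead
  of \<open>5\<close> because the covering lemma returns closed balls while the content uses open ones.\<close>

lemma content_maximal_weak_type:
  fixes g :: "'a::euclidean_space \<Rightarrow> ennreal"
  assumes g [measurable]: "g \<in> borel_measurable lebesgue"
    and fin: "(\<integral>\<^sup>+y. g y \<partial>lebesgue) \<le> ennreal m" and s: "s > 0" and \<beta>: "\<beta> > 0" and m: "m \<ge> 0"
  shows "hausdorff_content \<beta> {x. \<exists>r>0. ennreal (s * r powr \<beta>) < (\<integral>\<^sup>+y. g y * indicator (ball x r) y \<partial>lebesgue)}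
     \<le> ennreal (unit_ball_vol \<beta> * 6 powr \<beta> * m / s)"
proof -
  define \<mu> where "\<mu> = density lebesgue g"
  have \<mu>: "emeasure \<mu> (ball x r) = (\<integral>\<^sup>+y. g y * indicator (ball x r) y \<partial>lebesgue)" for x r
    unfolding \<mu>_def by (subst emeasure_density) auto
  have \<mu>_le: "emeasure \<mu> E \<le> ennreal m" for E
  proof -
    have "emeasure \<mu> E \<le> emeasure \<mu> (space \<mu>)" by (rule emeasure_space)
    also have "\<dots> = (\<integral>\<^sup>+y. g y \<partial>lebesgue)"
      unfolding \<mu>_def by (subst emeasure_density) (auto simp: space_density)
    finally show ?thesis using fin by (rule order_trans)
  qed
  define S where "S = {x. \<exists>r>0. ennreal (s * r powr \<beta>) < emeasure \<mu> (ball x r)}"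
  obtain \<rho> where \<rho>: "\<And>x. x \<in> S \<Longrightarrow> \<rho> x > 0 \<and> ennreal (s * \<rho> x powr \<beta>) < emeasure \<mu> (ball x (\<rho> x))"
    unfolding S_def by atomize_elim (rule choice, auto)
  have bd: "\<rho> x \<le> (m / s) powr (1 / \<beta>)" if "x \<in> S" for x
  proof -
    have "ennreal (s * \<rho> x powr \<beta>) \<le> ennreal m"
      using \<rho>[OF that] \<mu>_le order_trans less_imp_le by blast
    then have "s * \<rho> x powr \<beta> \<le> m" using m by (simp add: ennreal_le_iff)
    then have "\<rho> x powr \<beta> \<le> m / s" using s by (simp add: field_simps)
    then have "(\<rho> x powr \<beta>) powr (1 / \<beta>) \<le> (m / s) powr (1 / \<beta>)" using \<beta> by (intro powr_mono2) auto
    then show ?thesis using \<beta> \<rho>[OF that] by (simp add: powr_powr)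
  qed
  have "S \<subseteq> (\<Union>x\<in>S. cball x (\<rho> x))" using \<rho> by (force simp: less_imp_le)
  moreover have "0 < \<rho> x \<and> \<rho> x \<le> (m / s) powr (1 / \<beta>)" if "x \<in> S" for x using \<rho> bd that by auto
  ultimately obtain C where C: "countable C" "C \<subseteq> S"
      "pairwise (\<lambda>i j. disjnt (cball i (\<rho> i)) (cball j (\<rho> j))) C"
      "S \<subseteq> (\<Union>x\<in>C. cball x (5 * \<rho> x))"
    by (rule Vitali_covering_lemma_cballs[where a = "\<lambda>x. x"]) blast
  have "hausdorff_content \<beta> S \<le> hausdorff_content \<beta> (\<Union>x\<in>C. ball x (6 * \<rho> x))"
  proof (rule hausdorff_content_mono, rule order_trans[OF C(4)], rule UN_mono)
    fix x assume "x \<in> C"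
    then have "\<rho> x > 0" using C(2) \<rho> by auto
    then show "cball x (5 * \<rho> x) \<subseteq> ball x (6 * \<rho> x)" by auto
  qed simp
  also have "\<dots> \<le> (\<integral>\<^sup>+x. hausdorff_content \<beta> (ball x (6 * \<rho> x)) \<partial>count_space C)"
    by (rule hausdorff_content_UN_countable[OF C(1)])
  also have "\<dots> \<le> (\<integral>\<^sup>+x. ennreal (unit_ball_vol \<beta> * 6 powr \<beta> / s) * emeasure \<mu> (ball x (\<rho> x)) \<partial>count_space C)"
  proof (rule nn_integral_mono)
    fix x assume "x \<in> space (count_space C)"
    then have x: "\<rho> x > 0" "ennreal (s * \<rho> x powr \<beta>) \<le> emeasure \<mu> (ball x (\<rho> x))"
      using C(2) \<rho> by (auto intro: less_imp_le)
    have "hausdorff_content \<beta> (ball x (6 * \<rho> x)) \<le> ennreal (unit_ball_vol \<beta> * (6 * \<rho> x) powr \<beta>)"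
      using x by (intro hausdorff_content_ball) auto
    also have "\<dots> = ennreal (unit_ball_vol \<beta> * 6 powr \<beta> / s) * ennreal (s * \<rho> x powr \<beta>)"
      using x s \<beta> by (subst ennreal_mult[symmetric]) (auto simp: powr_mult unit_ball_vol_nonneg)
    also have "\<dots> \<le> ennreal (unit_ball_vol \<beta> * 6 powr \<beta> / s) * emeasure \<mu> (ball x (\<rho> x))"
      using x by (intro mult_left_mono) auto
    finally show "hausdorff_content \<beta> (ball x (6 * \<rho> x)) \<le>
      ennreal (unit_ball_vol \<beta> * 6 powr \<beta> / s) * emeasure \<mu> (ball x (\<rho> x))" .
  qed
  also have "\<dots> = ennreal (unit_ball_vol \<beta> * 6 powr \<beta> / s) * (\<integral>\<^sup>+x. emeasure \<mu> (ball x (\<rho> x)) \<partial>count_space C)"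
    by (rule nn_integral_cmult) auto
  also have "(\<integral>\<^sup>+x. emeasure \<mu> (ball x (\<rho> x)) \<partial>count_space C) = emeasure \<mu> (\<Union>x\<in>C. ball x (\<rho> x))"
  proof (rule emeasure_UN_countable[symmetric])
    show "disjoint_family_on (\<lambda>x. ball x (\<rho> x)) C"
      using C(3) ball_subset_cball
      unfolding disjoint_family_on_def pairwise_def disjnt_def by blast
  qed (auto simp: \<mu>_def C(1))
  also have "ennreal (unit_ball_vol \<beta> * 6 powr \<beta> / s) * emeasure \<mu> (\<Union>x\<in>C. ball x (\<rho> x))
      \<le> ennreal (unit_ball_vol \<beta> * 6 powr \<beta> / s) * ennreal m"
    by (intro mult_left_mono \<mu>_le) auto
  also have "\<dots> = ennreal (unit_ball_vol \<beta> * 6 powr \<beta> * m / s)"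
    using s m \<beta> by (subst ennreal_mult[symmetric]) (auto simp: unit_ball_vol_nonneg)
  finally show ?thesis unfolding S_def \<mu> .
qed

section \<open>Weak Lebesgue bounds on balls\<close>

text \<open>For \<open>A > 0\<close> this says that the weak \<open>L\<close>-\<open>q\<close> quasi-norm is at most \<open>A\<close>. The form with level
  sets is the one in which \<open>f\<close> can be cut off and split at given heights.\<close>

definition weak_bound :: "real \<Rightarrow> real \<Rightarrow> ('a::euclidean_space \<Rightarrow> real) \<Rightarrow> bool" where
  "weak_bound q A f \<longleftrightarrow> f \<in> borel_measurable lebesgue \<and>
     (\<forall>s>0. emeasure lebesgue {x. \<bar>f x\<bar> > s} \<le> ennreal ((A / s) powr q))"

lemma weak_bound_measurable: "weak_bound q A f \<Longrightarrow> f \<in> borel_measurable lebesgue"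
  by (simp add: weak_bound_def)

lemma weak_bound_indicator:
  assumes "weak_bound q A f" "E \<in> sets lebesgue"
  shows "weak_bound q A (\<lambda>y. f y * indicator E y)"
  unfolding weak_bound_def
proof (intro conjI allI impI)
  have [measurable]: "f \<in> borel_measurable lebesgue" "E \<in> sets lebesgue"
    using assms by (auto simp: weak_bound_def)
  show "(\<lambda>y. f y * indicator E y) \<in> borel_measurable lebesgue" by measurable
  fix s :: real assume s: "s > 0"
  have "emeasure lebesgue {x. \<bar>f x * indicator E x\<bar> > s} \<le> emeasure lebesgue {x\<in>space lebesgue. \<bar>f x\<bar> > s}"
  proof (rule emeasure_mono)
    show "{x\<in>space lebesgue. \<bar>f x\<bar> > s} \<in> sets lebesgue" by measurable
  qed (use s in \<open>auto split: split_indicator_asm\<close>)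
  also have "\<dots> \<le> ennreal ((A / s) powr q)" using assms s by (simp add: weak_bound_def)
  finally show "emeasure lebesgue {x. \<bar>f x * indicator E x\<bar> > s} \<le> ennreal ((A / s) powr q)" .
qed

lemma emeasure_ball_powr:
  "r \<ge> 0 \<Longrightarrow> emeasure lborel (ball (x::'a::euclidean_space) r)
     = ennreal (unit_ball_vol (real DIM('a)) * r powr real DIM('a))"
  by (cases "r = 0") (auto simp: emeasure_ball powr_realpow)

lemma geometric_suminf_ennreal:
  assumes "0 \<le> K" "0 \<le> x" "x < 1"
  shows "(\<Sum>j. ennreal (K * x ^ j)) = ennreal (K / (1 - x))"
  using assms sums_mult[OF geometric_sums, of x K]
  by (intro sums_unique[symmetric] sums_ennreal[THEN iffD2]) auto

lemma ennreal_le_suminf: "f k \<le> suminf f" for f :: "nat \<Rightarrow> ennreal"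
  using sum_le_suminf[of f "{k}"] by simp

lemma ball_lebesgue [measurable]: "ball (x :: 'a::euclidean_space) r \<in> sets lebesgue"
  by simp

lemma dyadic_shell:
  fixes t :: real
  assumes "t > 1"
  obtains j :: nat where "2 ^ j < t" "t \<le> 2 ^ (j + 1)"
proof -
  define j where "j = nat \<lceil>log 2 t\<rceil> - 1"
  have "log 2 t > 0" using assms by simp
  then have "real j < log 2 t" "log 2 t \<le> real (j + 1)" unfolding j_def by linarith+
  then have "2 powr real j < t" "t \<le> 2 powr real (j + 1)"
    using assms by (simp_all only: less_log_iff log_le_iff)
  then show thesis using that by (simp only: powr_realpow)
qed

definition kolmogorov_const :: "real \<Rightarrow> real \<Rightarrow> real \<Rightarrow> real" where
  "kolmogorov_const n \<alpha> p = unit_ball_vol n + 2 powr p / (1 - 2 powr (p - n / \<alpha>))"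

text \<open>Kolmogorov's inequality. Below the height \<open>T = A r\<close> to the power \<open>-\<alpha>\<close> the integrand is
  bounded by \<open>T\<^sup>p\<close>; above it, \<open>|f|\<close> is cut at the heights \<open>T 2\<^sup>j\<close>, and the distributional
  bound turns the pieces into a geometric series, convergent because \<open>p < n / \<alpha>\<close>. This \<open>T\<close> is
  the height at which the level set can be as large as the ball, so both contributions have
  the same size.\<close>

lemma kolmogorov_ball:
  fixes f :: "'a::euclidean_space \<Rightarrow> real"
  assumes f: "weak_bound (real DIM('a) / \<alpha>) A f" and A: "A > 0" and \<alpha>: "\<alpha> > 0"
    and p: "0 < p" "p < real DIM('a) / \<alpha>" and r: "r > 0"
  shows "(\<integral>\<^sup>+y. ennreal (\<bar>f y\<bar> powr p) * indicator (ball x r) y \<partial>lebesgue)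
     \<le> ennreal (kolmogorov_const (real DIM('a)) \<alpha> p * A powr p * r powr (real DIM('a) - \<alpha> * p))"
proof -
  define n where "n = real DIM('a)"
  define q where "q = n / \<alpha>"
  define T where "T = A * r powr (- \<alpha>)"
  have n: "n > 0" by (simp add: n_def)
  have T: "T > 0" using A r by (simp add: T_def)
  have pq: "p < q" using p by (simp add: q_def n_def)
  have \<alpha>q: "\<alpha> * q = n" using \<alpha> by (simp add: q_def)
  have [measurable]: "f \<in> borel_measurable lebesgue" using f by (simp add: weak_bound_def)
  define E where "E k = {y. \<bar>f y\<bar> > T * 2 ^ k}" for k :: nat
  have Em [measurable]: "E k \<in> sets lebesgue" for k
  proof -
    have "{y\<in>space lebesgue. \<bar>f y\<bar> > T * 2 ^ k} \<in> sets lebesgue" by measurable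
    then show ?thesis by (simp add: E_def)
  qed
  let ?g = "\<lambda>k y. ennreal (2 powr p * T powr p * (2 powr p) ^ k) * indicator (E k) y"
  have pt: "ennreal (\<bar>f y\<bar> powr p) * indicator (ball x r) y
      \<le> ennreal (T powr p) * indicator (ball x r) y + (\<Sum>k. ?g k y)" for y
  proof (cases "\<bar>f y\<bar> \<le> T")
    case True
    then have "\<bar>f y\<bar> powr p \<le> T powr p" using p by (intro powr_mono2) auto
    then have "ennreal (\<bar>f y\<bar> powr p) * indicator (ball x r) y \<le> ennreal (T powr p) * indicator (ball x r) y"
      by (intro mult_right_mono ennreal_leI) auto
    then show ?thesis by (simp add: add_increasing2)
  next
    case False
    have "1 < \<bar>f y\<bar> / T" using False T by (simp add: field_simps)
    then obtain k where k: "2 ^ k < \<bar>f y\<bar> / T" "\<bar>f y\<bar> / T \<le> 2 ^ (k + 1)" by (rule dyadic_shell)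
    have yE: "y \<in> E k" using k(1) T by (simp add: E_def field_simps)
    have "\<bar>f y\<bar> / T \<le> 2 powr (real k + 1)" using k(2) by (simp add: powr_add powr_realpow mult.commute)
    then have "\<bar>f y\<bar> \<le> 2 powr (real k + 1) * T" using T by (simp add: field_simps)
    then have "\<bar>f y\<bar> powr p \<le> (2 powr (real k + 1) * T) powr p" using p by (intro powr_mono2) auto
    also have "\<dots> = 2 powr p * T powr p * (2 powr p) ^ k"
      using T by (simp add: powr_mult powr_powr powr_add[symmetric] powr_realpow[symmetric] algebra_simps)
    finally have "ennreal (\<bar>f y\<bar> powr p) \<le> ?g k y" using yE by (simp add: ennreal_leI)
    also have "\<dots> \<le> (\<Sum>k. ?g k y)"
      by (rule ennreal_le_suminf)
    finally have "ennreal (\<bar>f y\<bar> powr p) * indicator (ball x r) y \<le> (\<Sum>k. ?g k y)"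
      by (auto split: split_indicator)
    then show ?thesis by (simp add: add_increasing)
  qed
  have "(\<integral>\<^sup>+y. ennreal (\<bar>f y\<bar> powr p) * indicator (ball x r) y \<partial>lebesgue) \<le>
     (\<integral>\<^sup>+y. ennreal (T powr p) * indicator (ball x r) y + (\<Sum>k. ?g k y) \<partial>lebesgue)"
    by (intro nn_integral_mono pt)
  also have "\<dots> = (\<integral>\<^sup>+y. ennreal (T powr p) * indicator (ball x r) y \<partial>lebesgue) + (\<integral>\<^sup>+y. (\<Sum>k. ?g k y) \<partial>lebesgue)"
    by (intro nn_integral_add) measurable
  also have "(\<integral>\<^sup>+y. ennreal (T powr p) * indicator (ball x r) y \<partial>lebesgue) = ennreal (T powr p) * emeasure lebesgue (ball x r)"
    by (subst nn_integral_cmult_indicator) auto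
  also have "\<dots> = ennreal (unit_ball_vol n * A powr p * r powr (n - \<alpha> * p))"
  proof -
    have "T powr p * (unit_ball_vol n * r powr n) = unit_ball_vol n * A powr p * r powr (n - \<alpha> * p)"
      using A r by (simp add: T_def powr_mult powr_powr powr_diff powr_divide powr_minus divide_simps)
    then have "ennreal (T powr p) * ennreal (unit_ball_vol n * r powr n) = ennreal (unit_ball_vol n * A powr p * r powr (n - \<alpha> * p))"
      using n by (subst ennreal_mult[symmetric]) (auto simp: unit_ball_vol_nonneg)
    then show ?thesis using r by (simp add: emeasure_ball_powr n_def)
  qed
  also have "(\<integral>\<^sup>+y. (\<Sum>k. ?g k y) \<partial>lebesgue) = (\<Sum>k. \<integral>\<^sup>+y. ?g k y \<partial>lebesgue)"
    by (intro nn_integral_suminf) measurable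
  also have "\<dots> \<le> (\<Sum>k. ennreal (2 powr p * A powr p * r powr (n - \<alpha> * p) * (2 powr (p - q)) ^ k))"
  proof (intro suminf_le allI)
    fix k
    have "(\<integral>\<^sup>+y. ?g k y \<partial>lebesgue) = ennreal (2 powr p * T powr p * (2 powr p) ^ k) * emeasure lebesgue (E k)"
      by (subst nn_integral_cmult_indicator) auto
    also have "\<dots> \<le> ennreal (2 powr p * T powr p * (2 powr p) ^ k) * ennreal ((A / (T * 2 ^ k)) powr q)"
      using f T by (intro mult_left_mono) (auto simp: weak_bound_def E_def q_def n_def)
    also have "\<dots> = ennreal (2 powr p * T powr p * (2 powr p) ^ k * (A / (T * 2 ^ k)) powr q)"
      by (rule ennreal_mult[symmetric]) auto
    also have "2 powr p * T powr p * (2 powr p) ^ k * (A / (T * 2 ^ k)) powr q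
        = 2 powr p * A powr p * r powr (n - \<alpha> * p) * (2 powr (p - q)) ^ k"
    proof -
      have "A / (T * 2 ^ k) = r powr \<alpha> * 2 powr (- real k)"
        using A r by (simp add: T_def powr_minus powr_realpow field_simps)
      then have 1: "(A / (T * 2 ^ k)) powr q = r powr n * 2 powr (- real k * q)"
        using r by (simp add: powr_mult powr_powr \<alpha>q)
      have 2: "T powr p = A powr p * r powr (- \<alpha> * p)"
        using A r by (simp add: T_def powr_mult powr_powr)
      have 3: "(2 powr p :: real) ^ k = 2 powr (p * real k)" "(2 powr (p - q) :: real) ^ k = 2 powr ((p - q) * real k)"
        by (simp_all add: powr_realpow[symmetric] powr_powr)
      have 4: "2 powr (p * real k) * 2 powr (- real k * q) = (2::real) powr ((p - q) * real k)"
        by (simp add: powr_add[symmetric] algebra_simps)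
      have 5: "r powr (- \<alpha> * p) * r powr n = r powr (n - \<alpha> * p)"
        using r by (simp add: powr_add[symmetric] algebra_simps)
      show ?thesis unfolding 1 2 3 4[symmetric] 5[symmetric] by (simp only: mult_ac)
    qed
    finally show "(\<integral>\<^sup>+y. ?g k y \<partial>lebesgue) \<le> ennreal (2 powr p * A powr p * r powr (n - \<alpha> * p) * (2 powr (p - q)) ^ k)" .
  qed auto
  also have "\<dots> = ennreal (2 powr p * A powr p * r powr (n - \<alpha> * p) / (1 - 2 powr (p - q)))"
    using pq by (intro geometric_suminf_ennreal) (auto simp: powr_less_one)
  also have "ennreal (unit_ball_vol n * A powr p * r powr (n - \<alpha> * p)) + \<dots> =
      ennreal (unit_ball_vol n * A powr p * r powr (n - \<alpha> * p) + 2 powr p * A powr p * r powr (n - \<alpha> * p) / (1 - 2 powr (p - q)))"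
    using pq n by (intro ennreal_plus[symmetric]) (auto simp: powr_less_one less_imp_le unit_ball_vol_nonneg)
  also have "unit_ball_vol n * A powr p * r powr (n - \<alpha> * p) + 2 powr p * A powr p * r powr (n - \<alpha> * p) / (1 - 2 powr (p - q))
      = (unit_ball_vol n + 2 powr p / (1 - 2 powr (p - q))) * A powr p * r powr (n - \<alpha> * p)"
    by (simp add: algebra_simps)
  finally show ?thesis by (simp add: n_def q_def kolmogorov_const_def)
qed

text \<open>A Hoelder inequality in disguise: for every height \<open>T > 0\<close> one has \<open>|f| \<le> T + T\<^sup>1\<^sup>-\<^sup>p
  |f|\<^sup>p\<close>, and \<open>T\<close> is chosen so that both terms integrate to the same order over the ball.\<close>

lemma growth_L1_of_growth_Lp:
  fixes f :: "'a::euclidean_space \<Rightarrow> real"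
  assumes [measurable]: "f \<in> borel_measurable lebesgue" and p: "1 \<le> p" and s: "s > 0" and r: "r > 0"
    and le: "(\<integral>\<^sup>+y. ennreal (\<bar>f y\<bar> powr p) * indicator (ball x r) y \<partial>lebesgue) \<le> ennreal (s * r powr \<beta>)"
  shows "(\<integral>\<^sup>+y. ennreal \<bar>f y\<bar> * indicator (ball x r) y \<partial>lebesgue)
     \<le> ennreal ((unit_ball_vol (real DIM('a)) + 1) * s powr (1 / p) * r powr (real DIM('a) + (\<beta> - real DIM('a)) / p))"
proof -
  define n where "n = real DIM('a)"
  define T where "T = s powr (1 / p) * r powr ((\<beta> - n) / p)"
  have T: "T > 0" using s r by (simp add: T_def)
  have pt: "\<bar>f y\<bar> \<le> T + T powr (1 - p) * \<bar>f y\<bar> powr p" for y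
  proof (cases "\<bar>f y\<bar> \<le> T")
    case True then show ?thesis by (simp add: add_increasing2)
  next
    case False
    then have "\<bar>f y\<bar> = \<bar>f y\<bar> powr (1 - p) * \<bar>f y\<bar> powr p" using T by (simp add: powr_add[symmetric])
    also have "\<dots> \<le> T powr (1 - p) * \<bar>f y\<bar> powr p"
      using False T p by (intro mult_right_mono powr_mono2') auto
    finally show ?thesis using T by simp
  qed
  have "(\<integral>\<^sup>+y. ennreal \<bar>f y\<bar> * indicator (ball x r) y \<partial>lebesgue) \<le>
     (\<integral>\<^sup>+y. ennreal T * indicator (ball x r) y +
        ennreal (T powr (1 - p)) * (ennreal (\<bar>f y\<bar> powr p) * indicator (ball x r) y) \<partial>lebesgue)"
  proof (intro nn_integral_mono)
    fix y
    have "ennreal \<bar>f y\<bar> \<le> ennreal (T + T powr (1 - p) * \<bar>f y\<bar> powr p)" by (intro ennreal_leI pt)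
    also have "\<dots> = ennreal T + ennreal (T powr (1 - p)) * ennreal (\<bar>f y\<bar> powr p)"
      using T by (simp add: ennreal_mult)
    finally show "ennreal \<bar>f y\<bar> * indicator (ball x r) y \<le> ennreal T * indicator (ball x r) y +
        ennreal (T powr (1 - p)) * (ennreal (\<bar>f y\<bar> powr p) * indicator (ball x r) y)"
      by (auto split: split_indicator)
  qed
  also have "\<dots> = ennreal T * emeasure lebesgue (ball x r) +
      ennreal (T powr (1 - p)) * (\<integral>\<^sup>+y. ennreal (\<bar>f y\<bar> powr p) * indicator (ball x r) y \<partial>lebesgue)"
  proof -
    have "(\<integral>\<^sup>+y. ennreal T * indicator (ball x r) y \<partial>lebesgue) = ennreal T * emeasure lebesgue (ball x r)"
      by (rule nn_integral_cmult_indicator) auto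
    moreover have "(\<integral>\<^sup>+y. ennreal (T powr (1 - p)) * (ennreal (\<bar>f y\<bar> powr p) * indicator (ball x r) y) \<partial>lebesgue)
        = ennreal (T powr (1 - p)) * (\<integral>\<^sup>+y. ennreal (\<bar>f y\<bar> powr p) * indicator (ball x r) y \<partial>lebesgue)"
      by (rule nn_integral_cmult) measurable
    moreover have "(\<integral>\<^sup>+y. ennreal T * indicator (ball x r) y +
        ennreal (T powr (1 - p)) * (ennreal (\<bar>f y\<bar> powr p) * indicator (ball x r) y) \<partial>lebesgue)
        = (\<integral>\<^sup>+y. ennreal T * indicator (ball x r) y \<partial>lebesgue) +
          (\<integral>\<^sup>+y. ennreal (T powr (1 - p)) * (ennreal (\<bar>f y\<bar> powr p) * indicator (ball x r) y) \<partial>lebesgue)"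
      by (rule nn_integral_add) measurable
    ultimately show ?thesis by (simp only:)
  qed
  also have "\<dots> \<le> ennreal T * ennreal (unit_ball_vol n * r powr n) + ennreal (T powr (1 - p)) * ennreal (s * r powr \<beta>)"
    using r le by (intro add_mono mult_left_mono) (auto simp: emeasure_ball_powr n_def)
  also have "\<dots> = ennreal (T * (unit_ball_vol n * r powr n) + T powr (1 - p) * (s * r powr \<beta>))"
    using T s r by (simp add: ennreal_mult[symmetric] unit_ball_vol_nonneg n_def)
  also have "T * (unit_ball_vol n * r powr n) + T powr (1 - p) * (s * r powr \<beta>)
      = (unit_ball_vol n + 1) * s powr (1 / p) * r powr (n + (\<beta> - n) / p)"
  proof -
    have 1: "T * r powr n = s powr (1 / p) * r powr (n + (\<beta> - n) / p)"
      using r by (simp add: T_def powr_add)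
    have e: "(1 - p) / p + 1 = 1 / p" using p by (simp add: field_simps)
    have e2: "(\<beta> - n) / p * (1 - p) + \<beta> = n + (\<beta> - n) / p" using p by (simp add: field_simps)
    have "T powr (1 - p) = s powr ((1 - p) / p) * r powr ((\<beta> - n) / p * (1 - p))"
      using s r by (simp add: T_def powr_mult powr_powr)
    then have "T powr (1 - p) * (s * r powr \<beta>)
       = (s powr ((1 - p) / p) * s powr 1) * (r powr ((\<beta> - n) / p * (1 - p)) * r powr \<beta>)"
      using s by simp
    also have "\<dots> = s powr (1 / p) * r powr (n + (\<beta> - n) / p)"
      unfolding powr_add[symmetric] e e2 ..
    finally show ?thesis using 1 by (simp add: algebra_simps)
  qed
  finally show ?thesis by (simp add: n_def)
qed

text \<open>An infinite level set would make the quasi-norm infinite, which is why the real part of the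
  measure loses nothing.\<close>

lemma weak_boundI:
  fixes f :: "'a::euclidean_space \<Rightarrow> real"
  assumes f: "f \<in> borel_measurable lebesgue" and q: "q > 0" and A: "A > 0"
    and le: "weak_Lp_norm q f \<le> ennreal A"
  shows "weak_bound q A f"
  unfolding weak_bound_def
proof (intro conjI allI impI f)
  fix s :: real assume s: "s > 0"
  define \<mu> where "\<mu> = emeasure lebesgue {x. \<bar>f x\<bar> > s}"
  have "ennreal s * ennreal_powr \<mu> (1 / q) \<le> weak_Lp_norm q f"
    unfolding weak_Lp_norm_def \<mu>_def by (rule SUP_upper) (use s in auto)
  then have *: "ennreal s * ennreal_powr \<mu> (1 / q) \<le> ennreal A" using le by (rule order_trans)
  have fin: "\<mu> \<noteq> \<infinity>"
  proof
    assume "\<mu> = \<infinity>"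
    then show False using * s by (simp add: ennreal_powr_def ennreal_mult_top top_unique)
  qed
  then have "s * enn2real \<mu> powr (1 / q) \<le> A"
    using * s A by (simp add: ennreal_powr_def ennreal_mult[symmetric])
  then have "enn2real \<mu> powr (1 / q) \<le> A / s" using s by (simp add: field_simps)
  then have "(enn2real \<mu> powr (1 / q)) powr q \<le> (A / s) powr q" using q by (intro powr_mono2) auto
  then have "enn2real \<mu> \<le> (A / s) powr q" using q by (simp add: powr_powr)
  then have "ennreal (enn2real \<mu>) \<le> ennreal ((A / s) powr q)" by (rule ennreal_leI)
  moreover have "ennreal (enn2real \<mu>) = \<mu>" using fin by (simp add: ennreal_enn2real_if)
  ultimately show "emeasure lebesgue {x. \<bar>f x\<bar> > s} \<le> ennreal ((A / s) powr q)"
    unfolding \<mu>_def[symmetric] by (simp only:)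
qed

lemma weak_Lp_norm_eq_0_imp_AE:
  fixes f :: "'a::euclidean_space \<Rightarrow> real"
  assumes [measurable]: "f \<in> borel_measurable lebesgue" and z: "weak_Lp_norm q f = 0"
  shows "AE x in lebesgue. f x = 0"
proof -
  have "AE x in lebesgue. \<not> \<bar>f x\<bar> > inverse (real (Suc j))" for j
  proof -
    define s where "s = inverse (real (Suc j))"
    have s: "s > 0" by (simp add: s_def)
    define \<mu> where "\<mu> = emeasure lebesgue {x. \<bar>f x\<bar> > s}"
    have "ennreal s * ennreal_powr \<mu> (1 / q) \<le> weak_Lp_norm q f"
      unfolding weak_Lp_norm_def \<mu>_def by (rule SUP_upper) (use s in auto)
    then have "ennreal_powr \<mu> (1 / q) = 0" using z s by simp
    then have "\<mu> \<noteq> \<infinity>" "enn2real \<mu> = 0" by (auto simp: ennreal_powr_def split: if_splits)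
    then have "\<mu> = 0" by (simp add: enn2real_eq_0_iff)
    moreover have "{x \<in> space lebesgue. \<bar>f x\<bar> > s} \<in> sets lebesgue" by measurable
    ultimately show ?thesis unfolding s_def[symmetric] \<mu>_def
      by (subst AE_iff_measurable[where N = "{x. \<bar>f x\<bar> > s}"]) auto
  qed
  then have "AE x in lebesgue. \<forall>j. \<not> \<bar>f x\<bar> > inverse (real (Suc j))" by (simp add: AE_all_countable)
  then show ?thesis
  proof eventually_elim
    case (elim x)
    then show ?case using reals_Archimedean[of "\<bar>f x\<bar>"] by auto
  qed
qed

section \<open>The Riesz kernel near and away from its pole\<close>

lemma measurable_kernel [measurable]:
  "(\<lambda>y::'a::euclidean_space. norm (x - y) powr c) \<in> borel_measurable lebesgue"
  by (intro measurable_completion) measurable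

lemma measurable_truncated_kernel [measurable]:
  "(\<lambda>y::'a::euclidean_space. max (norm (x - y)) \<delta> powr c) \<in> borel_measurable lebesgue"
  by (intro measurable_completion) measurable

text \<open>The mean value theorem for the radial profile of the Riesz kernel and of its truncations.\<close>

lemma neg_powr_lipschitz:
  fixes a b m k :: real
  assumes "0 < m" "m \<le> a" "m \<le> b" "0 \<le> k"
  shows "\<bar>a powr (-k) - b powr (-k)\<bar> \<le> k * m powr (-k - 1) * \<bar>a - b\<bar>"
proof -
  have "norm (a powr (-k) - b powr (-k)) \<le> k * m powr (-k - 1) * norm (a - b)"
  proof (rule field_differentiable_bound[where S = "{m..}" and f = "\<lambda>t. t powr (-k)"
        and f' = "\<lambda>t. -k * t powr (-k - 1)"])
    fix t assume t: "t \<in> {m..}"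
    then show "((\<lambda>t. t powr (-k)) has_field_derivative -k * t powr (-k - 1)) (at t within {m..})"
      using assms by (auto intro!: derivative_eq_intros)
    have "t powr (-k - 1) \<le> m powr (-k - 1)" using t assms by (intro powr_mono2') auto
    then show "norm (-k * t powr (-k - 1)) \<le> k * m powr (-k - 1)"
      using assms by (simp add: abs_mult mult_left_mono)
  qed (use assms in auto)
  then show ?thesis by simp
qed

lemma integrable_of_nn_integral_le:
  fixes h :: "'a \<Rightarrow> real"
  assumes "h \<in> borel_measurable M" "(\<integral>\<^sup>+y. ennreal \<bar>h y\<bar> \<partial>M) \<le> ennreal c" "c \<ge> 0"
  shows "integrable M h" "\<bar>integral\<^sup>L M h\<bar> \<le> c"
proof -
  have "(\<integral>\<^sup>+y. ennreal \<bar>h y\<bar> \<partial>M) < \<infinity>" using assms(2) le_less_trans by fastforce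
  then show i: "integrable M h" using assms(1) by (intro integrableI_bounded) auto
  have "\<bar>integral\<^sup>L M h\<bar> \<le> (\<integral>y. \<bar>h y\<bar> \<partial>M)"
    using integral_norm_bound[of M h] by simp
  also have "ennreal (\<integral>y. \<bar>h y\<bar> \<partial>M) \<le> ennreal c"
    using assms(2) i by (subst nn_integral_eq_integral[symmetric]) auto
  then have "(\<integral>y. \<bar>h y\<bar> \<partial>M) \<le> c" using assms(3) by (simp add: ennreal_le_iff)
  finally show "\<bar>integral\<^sup>L M h\<bar> \<le> c" .
qed

text \<open>The part of the Riesz integral of \<open>|f|\<close> at \<open>x\<close> that comes from \<open>ball x \<rho>\<close>, without the
  normalising factor and with values in the extended reals; the kernel has order \<open>k = n - \<alpha>\<close>.\<close>

definition near_potential :: "real \<Rightarrow> ('a::euclidean_space \<Rightarrow> real) \<Rightarrow> 'a \<Rightarrow> real \<Rightarrow> ennreal" where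
  "near_potential k f x \<rho> =
     (\<integral>\<^sup>+y. ennreal (\<bar>f y\<bar> * norm (x - y) powr (-k)) * indicator (ball x \<rho>) y \<partial>lebesgue)"

definition ball_mass :: "('a::euclidean_space \<Rightarrow> real) \<Rightarrow> 'a \<Rightarrow> real \<Rightarrow> ennreal" where
  "ball_mass f x r = (\<integral>\<^sup>+y. ennreal \<bar>f y\<bar> * indicator (ball x r) y \<partial>lebesgue)"

lemma near_potential_shell:
  assumes [measurable]: "f \<in> borel_measurable lebesgue" and "\<rho> > 0" "k \<ge> 0"
  shows "near_potential k f x \<rho> \<le> near_potential k f x (\<rho> / 2) + ennreal ((\<rho> / 2) powr (-k)) * ball_mass f x \<rho>"
proof -
  have pt: "ennreal (\<bar>f y\<bar> * norm (x - y) powr (-k)) * indicator (ball x \<rho>) y \<le>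
      ennreal (\<bar>f y\<bar> * norm (x - y) powr (-k)) * indicator (ball x (\<rho> / 2)) y +
      ennreal ((\<rho> / 2) powr (-k)) * (ennreal \<bar>f y\<bar> * indicator (ball x \<rho>) y)" for y
  proof (cases "y \<in> ball x \<rho> \<and> y \<notin> ball x (\<rho> / 2)")
    case True
    then have "\<rho> / 2 \<le> norm (x - y)" by (auto simp: dist_norm)
    then have "norm (x - y) powr (-k) \<le> (\<rho> / 2) powr (-k)" using assms by (intro powr_mono2') auto
    then have "ennreal (norm (x - y) powr (-k) * \<bar>f y\<bar>) \<le> ennreal ((\<rho> / 2) powr (-k) * \<bar>f y\<bar>)"
      by (intro ennreal_leI mult_right_mono) auto
    then show ?thesis using True by (simp add: ennreal_mult[symmetric] mult.commute)
  next
    case False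
    then show ?thesis using \<open>\<rho> > 0\<close> by (auto split: split_indicator)
  qed
  have "near_potential k f x \<rho> \<le> (\<integral>\<^sup>+y. ennreal (\<bar>f y\<bar> * norm (x - y) powr (-k)) * indicator (ball x (\<rho> / 2)) y +
      ennreal ((\<rho> / 2) powr (-k)) * (ennreal \<bar>f y\<bar> * indicator (ball x \<rho>) y) \<partial>lebesgue)"
    unfolding near_potential_def by (intro nn_integral_mono pt)
  also have "\<dots> = near_potential k f x (\<rho> / 2) +
     (\<integral>\<^sup>+y. ennreal ((\<rho> / 2) powr (-k)) * (ennreal \<bar>f y\<bar> * indicator (ball x \<rho>) y) \<partial>lebesgue)"
    unfolding near_potential_def by (rule nn_integral_add) measurable
  also have "(\<integral>\<^sup>+y. ennreal ((\<rho> / 2) powr (-k)) * (ennreal \<bar>f y\<bar> * indicator (ball x \<rho>) y) \<partial>lebesgue)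
     = ennreal ((\<rho> / 2) powr (-k)) * ball_mass f x \<rho>"
    unfolding ball_mass_def by (rule nn_integral_cmult) measurable
  finally show ?thesis .
qed

text \<open>At the critical growth \<open>r\<^sup>k\<close> every dyadic shell is bounded by the same amount, so peeling
  off \<open>N\<close> of them costs a multiple of \<open>N\<close>. This linear growth in \<open>N\<close> against an exponentially
  small exceptional set is the source of the exponential integrability.\<close>

lemma near_potential_shells:
  assumes f: "f \<in> borel_measurable lebesgue" and \<rho>: "\<rho> > 0" and k: "k \<ge> 0" and D: "D \<ge> 0"
    and mass: "\<And>r. r > 0 \<Longrightarrow> ball_mass f x r \<le> ennreal (D * r powr k)"
  shows "near_potential k f x \<rho> \<le> near_potential k f x (\<rho> / 2 ^ N) + ennreal (real N * (2 powr k * D))"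
proof (induction N)
  case (Suc N)
  let ?r = "\<rho> / 2 ^ N"
  have r: "?r > 0" using \<rho> by simp
  have "near_potential k f x ?r \<le> near_potential k f x (?r / 2) + ennreal ((?r / 2) powr (-k)) * ball_mass f x ?r"
    by (rule near_potential_shell[OF f r k])
  also have "ennreal ((?r / 2) powr (-k)) * ball_mass f x ?r \<le> ennreal ((?r / 2) powr (-k)) * ennreal (D * ?r powr k)"
    by (intro mult_left_mono mass r) auto
  also have "\<dots> = ennreal ((?r / 2) powr (-k) * (D * ?r powr k))"
    using D by (intro ennreal_mult[symmetric]) auto
  also have "(?r / 2) powr (-k) * (D * ?r powr k) = 2 powr k * D"
  proof -
    have "(?r / 2) powr (-k) = ?r powr (-k) * 2 powr k"
      using r by (subst powr_divide) (auto simp: powr_minus divide_simps)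
    then show ?thesis using r by (simp add: powr_minus field_simps)
  qed
  finally have "near_potential k f x ?r \<le> near_potential k f x (?r / 2) + ennreal (2 powr k * D)"
    by (simp add: add_left_mono)
  then have "near_potential k f x \<rho> \<le> near_potential k f x (?r / 2) + ennreal (2 powr k * D) + ennreal (real N * (2 powr k * D))"
    using Suc.IH by (meson add_right_mono order_trans)
  also have "\<dots> = near_potential k f x (?r / 2) + (ennreal (2 powr k * D) + ennreal (real N * (2 powr k * D)))"
    by (simp only: add.assoc)
  also have "ennreal (2 powr k * D) + ennreal (real N * (2 powr k * D)) = ennreal (real (Suc N) * (2 powr k * D))"
    using D by (subst ennreal_plus[symmetric]) (auto simp: algebra_simps)
  finally show ?case by (simp add: mult.commute)
qed simp

text \<open>With a gain of \<open>r\<^sup>\<kappa>\<close> over the critical growth, the shells form a convergent geometric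
  series.\<close>

lemma near_potential_growth:
  assumes [measurable]: "f \<in> borel_measurable lebesgue" and \<rho>: "\<rho> > 0" and k: "k \<ge> 0" and D: "D \<ge> 0" and \<kappa>: "\<kappa> > 0"
    and mass: "\<And>r. r > 0 \<Longrightarrow> ball_mass f x r \<le> ennreal (D * r powr (k + \<kappa>))"
  shows "near_potential k f x \<rho> \<le> ennreal (D * 2 powr k * \<rho> powr \<kappa> / (1 - 2 powr (-\<kappa>)))"
proof -
  define r where "r j = \<rho> / 2 ^ j" for j :: nat
  have r: "r j > 0" for j using \<rho> by (simp add: r_def)
  let ?g = "\<lambda>j y. ennreal ((r j / 2) powr (-k)) * (ennreal \<bar>f y\<bar> * indicator (ball x (r j)) y)"
  have pt: "ennreal (\<bar>f y\<bar> * norm (x - y) powr (-k)) * indicator (ball x \<rho>) y \<le> (\<Sum>j. ?g j y)" for y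
  proof (cases "y \<in> ball x \<rho> \<and> y \<noteq> x")
    case True
    define d where "d = norm (x - y)"
    have d: "0 < d" "d < \<rho>" using True by (auto simp: d_def dist_norm)
    then obtain j where j: "2 ^ j < \<rho> / d" "\<rho> / d \<le> 2 ^ (j + 1)"
      using dyadic_shell[of "\<rho> / d"] by auto
    have "d < r j" "r j / 2 \<le> d" using j d by (simp_all add: r_def field_simps)
    then have y: "y \<in> ball x (r j)" and "d powr (-k) \<le> (r j / 2) powr (-k)"
      using k r[of j] by (auto simp: d_def dist_norm intro: powr_mono2')
    then have "ennreal (d powr (-k) * \<bar>f y\<bar>) \<le> ennreal ((r j / 2) powr (-k) * \<bar>f y\<bar>)"
      by (intro ennreal_leI mult_right_mono) auto
    then have "ennreal (\<bar>f y\<bar> * norm (x - y) powr (-k)) * indicator (ball x \<rho>) y \<le> ?g j y"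
      using True y by (simp add: ennreal_mult[symmetric] mult.commute d_def)
    also have "\<dots> \<le> (\<Sum>j. ?g j y)" by (rule ennreal_le_suminf)
    finally show ?thesis .
  next
    case False
    then show ?thesis by (auto split: split_indicator)
  qed
  have "near_potential k f x \<rho> \<le> (\<integral>\<^sup>+y. (\<Sum>j. ?g j y) \<partial>lebesgue)"
    unfolding near_potential_def by (intro nn_integral_mono pt)
  also have "\<dots> = (\<Sum>j. \<integral>\<^sup>+y. ?g j y \<partial>lebesgue)"
    by (intro nn_integral_suminf) measurable
  also have "\<dots> \<le> (\<Sum>j. ennreal (D * 2 powr k * \<rho> powr \<kappa> * (2 powr (-\<kappa>)) ^ j))"
  proof (intro suminf_le allI)
    fix j
    have "(\<integral>\<^sup>+y. ?g j y \<partial>lebesgue) = ennreal ((r j / 2) powr (-k)) * ball_mass f x (r j)"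
      unfolding ball_mass_def by (rule nn_integral_cmult) measurable
    also have "\<dots> \<le> ennreal ((r j / 2) powr (-k)) * ennreal (D * r j powr (k + \<kappa>))"
      by (intro mult_left_mono mass r) auto
    also have "\<dots> = ennreal ((r j / 2) powr (-k) * (D * r j powr (k + \<kappa>)))"
      using D by (intro ennreal_mult[symmetric]) auto
    also have "(r j / 2) powr (-k) * (D * r j powr (k + \<kappa>)) = D * 2 powr k * \<rho> powr \<kappa> * (2 powr (-\<kappa>)) ^ j"
    proof -
      have 1: "(r j / 2) powr (-k) = r j powr (-k) * 2 powr k"
        using r[of j] by (subst powr_divide) (auto simp: powr_minus divide_simps)
      have 2: "r j powr (-k) * r j powr (k + \<kappa>) = r j powr \<kappa>"
        by (simp add: powr_add[symmetric])
      have 3: "r j powr \<kappa> = \<rho> powr \<kappa> * (2 powr (-\<kappa>)) ^ j"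
      proof -
        have "(2 ^ j :: real) powr \<kappa> = (2 powr \<kappa>) ^ j"
          by (simp add: powr_realpow[symmetric] powr_powr mult.commute)
        moreover have "r j powr \<kappa> = \<rho> powr \<kappa> / (2 ^ j) powr \<kappa>" using \<rho> by (simp add: r_def powr_divide)
        ultimately show ?thesis by (simp add: powr_minus power_inverse divide_inverse)
      qed
      have "(r j / 2) powr (-k) * (D * r j powr (k + \<kappa>)) = D * 2 powr k * (r j powr (-k) * r j powr (k + \<kappa>))"
        unfolding 1 by (simp only: mult_ac)
      then show ?thesis unfolding 2 3 by (simp only: mult_ac)
    qed
    finally show "(\<integral>\<^sup>+y. ?g j y \<partial>lebesgue) \<le> ennreal (D * 2 powr k * \<rho> powr \<kappa> * (2 powr (-\<kappa>)) ^ j)" .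
  qed auto
  also have "\<dots> = ennreal (D * 2 powr k * \<rho> powr \<kappa> / (1 - 2 powr (-\<kappa>)))"
    using D \<kappa> by (intro geometric_suminf_ennreal) (auto simp: powr_less_one)
  finally show ?thesis .
qed

text \<open>The kernel difference decays like the power \<open>-k - 1\<close>, one more than the kernel, and this
  extra power makes the sum over the outer shells converge.\<close>

lemma far_mass:
  assumes [measurable]: "f \<in> borel_measurable lebesgue" and R: "R > 0" and k: "k \<ge> 0" and D: "D \<ge> 0"
    and mass: "\<And>r. r > 0 \<Longrightarrow> ball_mass f c r \<le> ennreal (D * r powr k)"
  shows "(\<integral>\<^sup>+y. ennreal (\<bar>f y\<bar> * norm (c - y) powr (-k - 1)) * indicator (- cball c R) y \<partial>lebesgue)
     \<le> ennreal (2 * 4 powr k * D / R)"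
proof -
  define r where "r j = R * 2 ^ j" for j :: nat
  have r: "r j > 0" for j using R by (simp add: r_def)
  let ?g = "\<lambda>j y. ennreal (r j powr (-k - 1)) * (ennreal \<bar>f y\<bar> * indicator (ball c (4 * r j)) y)"
  have pt: "ennreal (\<bar>f y\<bar> * norm (c - y) powr (-k - 1)) * indicator (- cball c R) y \<le> (\<Sum>j. ?g j y)" for y
  proof (cases "y \<in> cball c R")
    case False
    define d where "d = norm (c - y)"
    have d: "R < d" using False by (auto simp: d_def dist_norm)
    then obtain j where j: "2 ^ j < d / R" "d / R \<le> 2 ^ (j + 1)"
      using dyadic_shell[of "d / R"] R by auto
    have d2: "r j \<le> d" "d \<le> 2 * r j" using j R by (simp_all add: r_def field_simps)
    then have "d < 4 * r j" using r[of j] by linarith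
    then have y: "y \<in> ball c (4 * r j)" and "d powr (-k - 1) \<le> r j powr (-k - 1)"
      using k r[of j] d2 by (auto simp: d_def dist_norm intro: powr_mono2')
    then have "ennreal (d powr (-k - 1) * \<bar>f y\<bar>) \<le> ennreal (r j powr (-k - 1) * \<bar>f y\<bar>)"
      by (intro ennreal_leI mult_right_mono) auto
    then have "ennreal (\<bar>f y\<bar> * norm (c - y) powr (-k - 1)) * indicator (- cball c R) y \<le> ?g j y"
      using False y by (simp add: ennreal_mult[symmetric] mult.commute d_def)
    also have "\<dots> \<le> (\<Sum>j. ?g j y)" by (rule ennreal_le_suminf)
    finally show ?thesis .
  qed auto
  have "(\<integral>\<^sup>+y. ennreal (\<bar>f y\<bar> * norm (c - y) powr (-k - 1)) * indicator (- cball c R) y \<partial>lebesgue)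
      \<le> (\<integral>\<^sup>+y. (\<Sum>j. ?g j y) \<partial>lebesgue)"
    by (intro nn_integral_mono pt)
  also have "\<dots> = (\<Sum>j. \<integral>\<^sup>+y. ?g j y \<partial>lebesgue)"
    by (intro nn_integral_suminf) measurable
  also have "\<dots> \<le> (\<Sum>j. ennreal (4 powr k * D / R * (1 / 2) ^ j))"
  proof (intro suminf_le allI)
    fix j
    have "(\<integral>\<^sup>+y. ?g j y \<partial>lebesgue) = ennreal (r j powr (-k - 1)) * ball_mass f c (4 * r j)"
      unfolding ball_mass_def by (rule nn_integral_cmult) measurable
    also have "\<dots> \<le> ennreal (r j powr (-k - 1)) * ennreal (D * (4 * r j) powr k)"
      using r[of j] by (intro mult_left_mono mass) auto
    also have "\<dots> = ennreal (r j powr (-k - 1) * (D * (4 * r j) powr k))"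
      using D by (intro ennreal_mult[symmetric]) auto
    also have "r j powr (-k - 1) * (D * (4 * r j) powr k) = 4 powr k * D / R * (1 / 2) ^ j"
    proof -
      have "r j powr (-k - 1) * r j powr k = inverse (r j)"
        using r[of j] by (simp add: powr_add[symmetric] powr_minus)
      moreover have "r j powr (-k - 1) * (D * (4 * r j) powr k) = 4 powr k * D * (r j powr (-k - 1) * r j powr k)"
        using r[of j] by (simp add: powr_mult)
      moreover have "inverse (r j) = 1 / R * (1 / 2) ^ j" by (simp add: r_def field_simps)
      ultimately show ?thesis by (simp only: times_divide_eq_right mult_1_right times_divide_eq_left mult.assoc)
    qed
    finally show "(\<integral>\<^sup>+y. ?g j y \<partial>lebesgue) \<le> ennreal (4 powr k * D / R * (1 / 2) ^ j)" .
  qed auto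
  also have "\<dots> = ennreal (4 powr k * D / R / (1 - 1 / 2))"
    using D R by (intro geometric_suminf_ennreal) auto
  finally show ?thesis by (simp add: mult_ac)
qed

text \<open>For \<open>y\<close> outside \<open>cball c R\<close> both \<open>x\<close> and \<open>z\<close> keep distance at least \<open>norm (c - y) / 2\<close> from
  \<open>y\<close>, so the difference of the two kernels is of order \<open>norm (x - z)\<close> times the weight in
  \<open>far_mass\<close>. Absolute convergence at a single point \<open>z\<close> has to be assumed: the critical
  growth of the mass alone bounds the kernel differences but not the integral itself.\<close>

lemma far_potential_lipschitz:
  fixes f :: "'a::euclidean_space \<Rightarrow> real"
  assumes [measurable]: "f \<in> borel_measurable lebesgue" and R: "R > 0" and k: "k \<ge> 0" and D: "D \<ge> 0"
    and mass: "\<And>r. r > 0 \<Longrightarrow> ball_mass f c r \<le> ennreal (D * r powr k)"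
    and x: "x \<in> ball c (R / 2)" and z: "z \<in> ball c (R / 2)"
    and int: "integrable lebesgue (\<lambda>y. f y * indicator (- cball c R) y * norm (z - y) powr (-k))"
  shows "integrable lebesgue (\<lambda>y. f y * indicator (- cball c R) y * norm (x - y) powr (-k))" (is ?i)
    and "\<bar>(\<integral>y. f y * indicator (- cball c R) y * norm (x - y) powr (-k) \<partial>lebesgue) -
          (\<integral>y. f y * indicator (- cball c R) y * norm (z - y) powr (-k) \<partial>lebesgue)\<bar>
       \<le> 4 * k * 8 powr k * D * norm (x - z) / R" (is ?b)
proof -
  have [measurable]: "cball c R \<in> sets lebesgue" by simp
  let ?f = "\<lambda>y. f y * indicator (- cball c R) y"
  define h where "h y = ?f y * norm (x - y) powr (-k) - ?f y * norm (z - y) powr (-k)" for y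
  have hm: "h \<in> borel_measurable lebesgue" unfolding h_def by measurable
  define L where "L = k * 2 powr (k + 1) * norm (x - z)"
  have L: "L \<ge> 0" using k by (simp add: L_def)
  have pt: "ennreal \<bar>h y\<bar> \<le> ennreal L * (ennreal (\<bar>f y\<bar> * norm (c - y) powr (-k - 1)) * indicator (- cball c R) y)" for y
  proof (cases "y \<in> cball c R")
    case False
    define m where "m = norm (c - y) / 2"
    have cy: "norm (c - y) > R" using False by (simp add: dist_norm)
    have m: "0 < m" "m \<le> norm (x - y)" "m \<le> norm (z - y)"
    proof -
      show "0 < m" using cy R unfolding m_def by linarith
      have *: "m \<le> norm (w - y)" if "w \<in> ball c (R / 2)" for w
      proof -
        have "norm (c - y) \<le> norm (c - w) + norm (w - y)"
          using norm_triangle_ineq[of "c - w" "w - y"] by simp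
        moreover have "norm (c - w) < R / 2" using that by (simp add: dist_norm)
        ultimately show ?thesis using cy unfolding m_def by linarith
      qed
      show "m \<le> norm (x - y)" "m \<le> norm (z - y)" using * x z by auto
    qed
    have "\<bar>norm (x - y) powr (-k) - norm (z - y) powr (-k)\<bar> \<le> k * m powr (-k - 1) * \<bar>norm (x - y) - norm (z - y)\<bar>"
      by (rule neg_powr_lipschitz[OF m k])
    also have "\<dots> \<le> k * m powr (-k - 1) * norm (x - z)"
      using k norm_triangle_ineq3[of "x - y" "z - y"] by (intro mult_left_mono) auto
    also have "m powr (-k - 1) = 2 powr (k + 1) * norm (c - y) powr (-k - 1)"
    proof -
      have "m powr (-k - 1) = norm (c - y) powr (-k - 1) / 2 powr (-k - 1)"
        unfolding m_def by (rule powr_divide)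
      also have "2 powr (-k - 1) = inverse ((2::real) powr (k + 1))"
        using powr_minus[of "2::real" "k + 1"] by simp
      finally show ?thesis by (simp add: field_simps)
    qed
    finally have "\<bar>norm (x - y) powr (-k) - norm (z - y) powr (-k)\<bar> \<le> L * norm (c - y) powr (-k - 1)"
      by (simp add: L_def mult_ac)
    then have "\<bar>f y\<bar> * \<bar>norm (x - y) powr (-k) - norm (z - y) powr (-k)\<bar> \<le> \<bar>f y\<bar> * (L * norm (c - y) powr (-k - 1))"
      by (intro mult_left_mono) auto
    then have "\<bar>h y\<bar> \<le> L * (\<bar>f y\<bar> * norm (c - y) powr (-k - 1))"
      using False by (simp add: h_def right_diff_distrib[symmetric] abs_mult mult_ac)
    then show ?thesis using False L by (simp add: ennreal_mult[symmetric] ennreal_leI)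
  qed (simp add: h_def)
  have "(\<integral>\<^sup>+y. ennreal \<bar>h y\<bar> \<partial>lebesgue) \<le> (\<integral>\<^sup>+y. ennreal L * (ennreal (\<bar>f y\<bar> * norm (c - y) powr (-k - 1)) * indicator (- cball c R) y) \<partial>lebesgue)"
    by (intro nn_integral_mono pt)
  also have "\<dots> = ennreal L * (\<integral>\<^sup>+y. ennreal (\<bar>f y\<bar> * norm (c - y) powr (-k - 1)) * indicator (- cball c R) y \<partial>lebesgue)"
    by (rule nn_integral_cmult) measurable
  also have "\<dots> \<le> ennreal L * ennreal (2 * 4 powr k * D / R)"
    by (intro mult_left_mono far_mass[OF _ R k D mass]) auto
  also have "\<dots> = ennreal (L * (2 * 4 powr k * D / R))"
    using L D R by (intro ennreal_mult[symmetric]) auto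
  finally have b: "(\<integral>\<^sup>+y. ennreal \<bar>h y\<bar> \<partial>lebesgue) \<le> ennreal (L * (2 * 4 powr k * D / R))" .
  have c0: "L * (2 * 4 powr k * D / R) \<ge> 0" using L D R by auto
  note h = integrable_of_nn_integral_le[OF hm b c0]
  have eq: "?f y * norm (x - y) powr (-k) = h y + ?f y * norm (z - y) powr (-k)" for y by (simp add: h_def)
  show ?i unfolding eq by (intro Bochner_Integration.integrable_add h int)
  have "(\<integral>y. ?f y * norm (x - y) powr (-k) \<partial>lebesgue) = integral\<^sup>L lebesgue h + (\<integral>y. ?f y * norm (z - y) powr (-k) \<partial>lebesgue)"
    unfolding eq by (intro Bochner_Integration.integral_add h int)
  then have "\<bar>(\<integral>y. ?f y * norm (x - y) powr (-k) \<partial>lebesgue) - (\<integral>y. ?f y * norm (z - y) powr (-k) \<partial>lebesgue)\<bar> \<le> L * (2 * 4 powr k * D / R)"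
    using h(2) by simp
  also have "L * (2 * 4 powr k * D / R) = 4 * k * 8 powr k * D * norm (x - z) / R"
  proof -
    have "(8::real) powr k = 2 powr k * 4 powr k" by (simp add: powr_mult[symmetric])
    then show ?thesis by (simp add: L_def powr_add)
  qed
  finally show ?b .
qed

text \<open>Truncating the distance from below at \<open>\<delta>\<close> removes the pole, so the potential of an
  integrable function becomes Lipschitz. The truncated potentials serve as continuous
  approximations.\<close>

lemma truncated_potential_lipschitz:
  fixes g :: "'a::euclidean_space \<Rightarrow> real"
  assumes [measurable]: "g \<in> borel_measurable lebesgue" and m: "(\<integral>\<^sup>+y. ennreal \<bar>g y\<bar> \<partial>lebesgue) \<le> ennreal m" "m \<ge> 0"
    and \<delta>: "\<delta> > 0" and k: "k \<ge> 0"
  shows "integrable lebesgue (\<lambda>y. g y * max (norm (x - y)) \<delta> powr (-k))" (is ?i)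
    and "\<bar>(\<integral>y. g y * max (norm (x - y)) \<delta> powr (-k) \<partial>lebesgue) - (\<integral>y. g y * max (norm (z - y)) \<delta> powr (-k) \<partial>lebesgue)\<bar>
       \<le> k * \<delta> powr (-k - 1) * norm (x - z) * m" (is ?b)
proof -
  have i: "integrable lebesgue (\<lambda>y. g y * max (norm (x - y)) \<delta> powr (-k))" for x
  proof (rule integrable_of_nn_integral_le)
    have "(\<integral>\<^sup>+y. ennreal \<bar>g y * max (norm (x - y)) \<delta> powr (-k)\<bar> \<partial>lebesgue) \<le> (\<integral>\<^sup>+y. ennreal (\<delta> powr (-k)) * ennreal \<bar>g y\<bar> \<partial>lebesgue)"
    proof (intro nn_integral_mono)
      fix y
      have "max (norm (x - y)) \<delta> powr (-k) \<le> \<delta> powr (-k)" using \<delta> k by (intro powr_mono2') auto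
      then have "\<bar>g y\<bar> * max (norm (x - y)) \<delta> powr (-k) \<le> \<bar>g y\<bar> * \<delta> powr (-k)" by (intro mult_left_mono) auto
      then show "ennreal \<bar>g y * max (norm (x - y)) \<delta> powr (-k)\<bar> \<le> ennreal (\<delta> powr (-k)) * ennreal \<bar>g y\<bar>"
        by (simp add: ennreal_mult[symmetric] abs_mult mult.commute ennreal_leI)
    qed
    also have "\<dots> = ennreal (\<delta> powr (-k)) * (\<integral>\<^sup>+y. ennreal \<bar>g y\<bar> \<partial>lebesgue)" by (rule nn_integral_cmult) measurable
    also have "\<dots> \<le> ennreal (\<delta> powr (-k)) * ennreal m" by (intro mult_left_mono m) auto
    also have "\<dots> = ennreal (\<delta> powr (-k) * m)" using m by (intro ennreal_mult[symmetric]) auto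
    finally show "(\<integral>\<^sup>+y. ennreal \<bar>g y * max (norm (x - y)) \<delta> powr (-k)\<bar> \<partial>lebesgue) \<le> ennreal (\<delta> powr (-k) * m)" .
  qed (use m in auto)
  then show ?i .
  define L where "L = k * \<delta> powr (-k - 1) * norm (x - z)"
  have L: "L \<ge> 0" using k by (simp add: L_def)
  let ?h = "\<lambda>y. g y * max (norm (x - y)) \<delta> powr (-k) - g y * max (norm (z - y)) \<delta> powr (-k)"
  have "(\<integral>\<^sup>+y. ennreal \<bar>?h y\<bar> \<partial>lebesgue) \<le> (\<integral>\<^sup>+y. ennreal L * ennreal \<bar>g y\<bar> \<partial>lebesgue)"
  proof (intro nn_integral_mono)
    fix y
    have "\<bar>max (norm (x - y)) \<delta> powr (-k) - max (norm (z - y)) \<delta> powr (-k)\<bar>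
       \<le> k * \<delta> powr (-k - 1) * \<bar>max (norm (x - y)) \<delta> - max (norm (z - y)) \<delta>\<bar>"
      using \<delta> k by (intro neg_powr_lipschitz) auto
    also have "\<dots> \<le> k * \<delta> powr (-k - 1) * norm (x - z)"
    proof (intro mult_left_mono)
      show "\<bar>max (norm (x - y)) \<delta> - max (norm (z - y)) \<delta>\<bar> \<le> norm (x - z)"
        using norm_triangle_ineq3[of "x - y" "z - y"] by (auto simp: max_def)
    qed (use k in auto)
    finally have "\<bar>g y\<bar> * \<bar>max (norm (x - y)) \<delta> powr (-k) - max (norm (z - y)) \<delta> powr (-k)\<bar> \<le> \<bar>g y\<bar> * L"
      unfolding L_def by (intro mult_left_mono) auto
    then have "\<bar>?h y\<bar> \<le> L * \<bar>g y\<bar>" by (simp add: right_diff_distrib[symmetric] abs_mult mult_ac)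
    then show "ennreal \<bar>?h y\<bar> \<le> ennreal L * ennreal \<bar>g y\<bar>" using L by (simp add: ennreal_mult[symmetric] ennreal_leI)
  qed
  also have "\<dots> = ennreal L * (\<integral>\<^sup>+y. ennreal \<bar>g y\<bar> \<partial>lebesgue)" by (rule nn_integral_cmult) measurable
  also have "\<dots> \<le> ennreal L * ennreal m" by (intro mult_left_mono m) auto
  also have "\<dots> = ennreal (L * m)" using m L by (intro ennreal_mult[symmetric]) auto
  finally have "\<bar>integral\<^sup>L lebesgue ?h\<bar> \<le> L * m"
    by (intro integrable_of_nn_integral_le) (use L m in auto)
  then show ?b by (subst Bochner_Integration.integral_diff[OF i i, symmetric]) (simp add: L_def)
qed

text \<open>The truncated kernel differs from the kernel only inside \<open>ball x \<delta>\<close>, where it is the smaller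
  one. At \<open>y = x\<close> this fails, since \<open>0\<close> to a negative power is \<open>0\<close>; one point is a null set.\<close>

lemma truncated_potential_error:
  fixes g :: "'a::euclidean_space \<Rightarrow> real"
  assumes [measurable]: "g \<in> borel_measurable lebesgue" and k: "k \<ge> 0" and b: "b \<ge> 0"
    and near: "near_potential k g x \<delta> \<le> ennreal b"
    and int: "integrable lebesgue (\<lambda>y. g y * norm (x - y) powr (-k))"
      "integrable lebesgue (\<lambda>y. g y * max (norm (x - y)) \<delta> powr (-k))"
  shows "\<bar>(\<integral>y. g y * max (norm (x - y)) \<delta> powr (-k) \<partial>lebesgue) - (\<integral>y. g y * norm (x - y) powr (-k) \<partial>lebesgue)\<bar> \<le> b"
proof -
  let ?h = "\<lambda>y. g y * max (norm (x - y)) \<delta> powr (-k) - g y * norm (x - y) powr (-k)"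
  have "AE y in lebesgue. y \<noteq> x"
    by (intro AE_completion) (rule AE_lborel_singleton)
  then have "AE y in lebesgue. ennreal \<bar>?h y\<bar> \<le> ennreal (\<bar>g y\<bar> * norm (x - y) powr (-k)) * indicator (ball x \<delta>) y"
  proof (rule AE_mp, intro AE_I2 impI)
    fix y assume ne: "y \<noteq> x"
    show "ennreal \<bar>?h y\<bar> \<le> ennreal (\<bar>g y\<bar> * norm (x - y) powr (-k)) * indicator (ball x \<delta>) y"
    proof (cases "y \<in> ball x \<delta>")
      case True
      then have d: "norm (x - y) < \<delta>" by (simp add: dist_norm)
      have "max (norm (x - y)) \<delta> powr (-k) \<le> norm (x - y) powr (-k)"
        using ne k by (intro powr_mono2') auto
      then have "\<bar>max (norm (x - y)) \<delta> powr (-k) - norm (x - y) powr (-k)\<bar> \<le> norm (x - y) powr (-k)"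
        by simp
      then have "\<bar>g y\<bar> * \<bar>max (norm (x - y)) \<delta> powr (-k) - norm (x - y) powr (-k)\<bar> \<le> \<bar>g y\<bar> * norm (x - y) powr (-k)"
        by (intro mult_left_mono) auto
      then show ?thesis using True by (simp add: right_diff_distrib[symmetric] abs_mult ennreal_leI)
    next
      case False
      then have "max (norm (x - y)) \<delta> = norm (x - y)" by (simp add: dist_norm)
      then show ?thesis by simp
    qed
  qed
  then have "(\<integral>\<^sup>+y. ennreal \<bar>?h y\<bar> \<partial>lebesgue) \<le> near_potential k g x \<delta>"
    unfolding near_potential_def by (rule nn_integral_mono_AE)
  also note near
  finally have "(\<integral>\<^sup>+y. ennreal \<bar>?h y\<bar> \<partial>lebesgue) \<le> ennreal b" .
  moreover have "?h \<in> borel_measurable lebesgue" by measurable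
  ultimately have "\<bar>integral\<^sup>L lebesgue ?h\<bar> \<le> b"
    by (intro integrable_of_nn_integral_le b)
  then show ?thesis by (subst Bochner_Integration.integral_diff[OF int(2,1), symmetric])
qed

section \<open>Splitting the potential at a ball\<close>

text \<open>The exponent \<open>p\<close> lies in the window in which \<open>|f|\<^sup>p\<close> is locally integrable (\<open>\<alpha> p < n\<close>) and
  its \<open>\<beta>\<close>-dimensional growth improves on the critical one (\<open>n - \<beta> < \<alpha> p\<close>). The constants
  depend on the exponents only; this is what makes the final bounds uniform in \<open>f\<close> and the
  cube.\<close>

locale riesz_exponents =
  fixes n \<alpha> \<beta> p :: real
  assumes \<alpha>: "0 < \<alpha>" "\<alpha> < n" and \<beta>: "0 < \<beta>"
    and p: "1 \<le> p" "n - \<beta> < \<alpha> * p" "\<alpha> * p < n"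
begin

text \<open>\<open>\<kappa>\<close> is the gain over the critical growth off an exceptional set. \<open>C_near\<close>, \<open>C_far\<close> and
  \<open>C_heavy\<close> bound the inner shells, the Lipschitz constant of the far part and the content of
  the exceptional sets; \<open>C_osc\<close> is the resulting bound for the oscillation, normalised.\<close>

definition "k = n - \<alpha>"
definition "\<kappa> = \<alpha> + (\<beta> - n) / p"
definition "K1 = kolmogorov_const n \<alpha> 1"
definition "Kp = kolmogorov_const n \<alpha> p"
definition "C_near = (unit_ball_vol n + 1) * 2 powr k / (1 - 2 powr (-\<kappa>))"
definition "C_heavy = unit_ball_vol \<beta> * 6 powr \<beta> * Kp * 2 powr \<beta>"
definition "C_far = 4 * k * 8 powr k * K1"
definition "C_osc = (C_near + 2 powr k * K1 + C_far) / riesz_gamma n \<alpha>"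

lemma k_pos: "k > 0" using \<alpha> by (simp add: k_def)

lemma \<kappa>_pos: "\<kappa> > 0"
proof -
  have "\<kappa> = (\<alpha> * p - (n - \<beta>)) / p" using p by (simp add: \<kappa>_def field_simps)
  then show ?thesis using p by simp
qed

lemma p_less: "p < n / \<alpha>" using p \<alpha> by (simp add: field_simps)

lemma kolmogorov_const_pos: assumes "p' < n / \<alpha>" shows "kolmogorov_const n \<alpha> p' > 0"
proof -
  have "1 - 2 powr (p' - n / \<alpha>) > (0::real)" using assms by (simp add: powr_less_one)
  then show ?thesis unfolding kolmogorov_const_def
    using \<alpha> by (intro add_nonneg_pos unit_ball_vol_nonneg divide_pos_pos) auto
qed

lemma Kp_pos: "Kp > 0" and K1_pos: "K1 > 0"
  using kolmogorov_const_pos[of p] kolmogorov_const_pos[of 1] p p_less by (auto simp: Kp_def K1_def)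

lemma riesz_gamma_pos: "riesz_gamma n \<alpha> > 0"
  unfolding riesz_gamma_def using \<alpha> by (intro divide_pos_pos mult_pos_pos Gamma_real_pos) auto

lemma C_near_pos: "C_near > 0"
  unfolding C_near_def using \<kappa>_pos \<alpha> by (intro divide_pos_pos mult_pos_pos add_nonneg_pos unit_ball_vol_nonneg) (auto simp: powr_less_one)

lemma C_far_pos: "C_far > 0" using k_pos K1_pos by (simp add: C_far_def)

lemma C_heavy_pos: "C_heavy > 0" using Kp_pos \<beta> unit_ball_vol_pos[of \<beta>] by (simp add: C_heavy_def)

lemma C_osc_pos: "C_osc > 0"
  unfolding C_osc_def using C_near_pos C_far_pos K1_pos riesz_gamma_pos by (intro divide_pos_pos add_pos_pos mult_pos_pos) auto

end

text \<open>One function \<open>f\<close> with weak bound \<open>A\<close>, cut at \<open>cball c R\<close>; the potential is studied on the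
  concentric ball of radius \<open>R / 2\<close>.\<close>

locale riesz_local = riesz_exponents +
  fixes f :: "'a::euclidean_space \<Rightarrow> real" and A R :: real and c :: 'a
  assumes n: "n = real DIM('a)" and weak: "weak_bound (n / \<alpha>) A f" and A: "A > 0" and R: "R > 0"
begin

definition "near y = f y * indicator (cball c R) y"
definition "far y = f y * indicator (- cball c R) y"
definition "near_int x = (\<integral>y. near y * norm (x - y) powr (-k) \<partial>lebesgue)"
definition "far_int x = (\<integral>y. far y * norm (x - y) powr (-k) \<partial>lebesgue)"

text \<open>The exceptional set: some ball around the point carries too much of the measure with density
  \<open>|near|\<^sup>p\<close> compared with the content of the ball.\<close>

definition "heavy s = {x. \<exists>r>0. ennreal (s * r powr \<beta>) < (\<integral>\<^sup>+y. ennreal (\<bar>near y\<bar> powr p) * indicator (ball x r) y \<partial>lebesgue)}"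

lemma measurable_f [measurable]: "f \<in> borel_measurable lebesgue"
  using weak by (rule weak_bound_measurable)

lemma measurable_near [measurable]: "near \<in> borel_measurable lebesgue"
proof -
  have [measurable]: "cball c R \<in> sets lebesgue" by simp
  show ?thesis unfolding near_def by measurable
qed

lemma measurable_far [measurable]: "far \<in> borel_measurable lebesgue"
proof -
  have [measurable]: "cball c R \<in> sets lebesgue" by simp
  show ?thesis unfolding far_def by measurable
qed

lemma near_weak: "weak_bound (n / \<alpha>) A near"
  unfolding near_def by (rule weak_bound_indicator[OF weak]) simp

lemma ball_mass_le:
  fixes g :: "'a \<Rightarrow> real"
  assumes "weak_bound (n / \<alpha>) A g" "r > 0"
  shows "ball_mass g x r \<le> ennreal (K1 * A * r powr k)"
proof -
  have "(\<integral>\<^sup>+y. ennreal (\<bar>g y\<bar> powr 1) * indicator (ball x r) y \<partial>lebesgue) \<le> ennreal (K1 * A powr 1 * r powr (n - \<alpha> * 1))"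
    using kolmogorov_ball[of \<alpha> A g 1 r x] assms A \<alpha> p p_less
    by (simp add: n[symmetric] K1_def)
  then show ?thesis using A by (simp add: ball_mass_def k_def)
qed

lemma near_total_Lp: "(\<integral>\<^sup>+y. ennreal (\<bar>near y\<bar> powr p) \<partial>lebesgue) \<le> ennreal (Kp * A powr p * (2 * R) powr (n - \<alpha> * p))"
proof -
  have "(\<integral>\<^sup>+y. ennreal (\<bar>near y\<bar> powr p) \<partial>lebesgue) = (\<integral>\<^sup>+y. ennreal (\<bar>near y\<bar> powr p) * indicator (ball c (2 * R)) y \<partial>lebesgue)"
    using R p by (intro nn_integral_cong) (auto simp: near_def split: split_indicator)
  also have "\<dots> \<le> ennreal (Kp * A powr p * (2 * R) powr (n - \<alpha> * p))"
    using kolmogorov_ball[of \<alpha> A near p "2 * R" c] near_weak A \<alpha> p p_less R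
    by (simp add: n[symmetric] Kp_def)
  finally show ?thesis .
qed

lemma near_total: "(\<integral>\<^sup>+y. ennreal \<bar>near y\<bar> \<partial>lebesgue) \<le> ennreal (K1 * A * (2 * R) powr k)"
proof -
  have "(\<integral>\<^sup>+y. ennreal \<bar>near y\<bar> \<partial>lebesgue) = ball_mass near c (2 * R)"
    unfolding ball_mass_def using R by (intro nn_integral_cong) (auto simp: near_def split: split_indicator)
  also have "\<dots> \<le> ennreal (K1 * A * (2 * R) powr k)" using R by (intro ball_mass_le near_weak) auto
  finally show ?thesis .
qed

lemma open_heavy: "open (heavy s)"
  unfolding heavy_def by (rule open_maximal_set) measurable

lemma content_heavy:
  assumes "s > 0"
  shows "hausdorff_content \<beta> (heavy s) \<le> ennreal (unit_ball_vol \<beta> * 6 powr \<beta> * (Kp * A powr p * (2 * R) powr (n - \<alpha> * p)) / s)"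
  unfolding heavy_def using near_total_Lp assms \<beta> Kp_pos by (intro content_maximal_weak_type) auto

lemma near_potential_good:
  assumes x: "x \<notin> heavy s" and s: "s > 0" and \<rho>: "\<rho> > 0"
  shows "near_potential k near x \<rho> \<le> ennreal (C_near * s powr (1 / p) * \<rho> powr \<kappa>)"
proof -
  have "ball_mass near x r \<le> ennreal ((unit_ball_vol n + 1) * s powr (1 / p) * r powr (k + \<kappa>))" if r: "r > 0" for r
  proof -
    have "(\<integral>\<^sup>+y. ennreal (\<bar>near y\<bar> powr p) * indicator (ball x r) y \<partial>lebesgue) \<le> ennreal (s * r powr \<beta>)"
      using x r unfolding heavy_def mem_Collect_eq not_ex de_Morgan_conj not_less by (meson not_le)
    then have "ball_mass near x r \<le> ennreal ((unit_ball_vol n + 1) * s powr (1 / p) * r powr (n + (\<beta> - n) / p))"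
      unfolding ball_mass_def n using s r p by (intro growth_L1_of_growth_Lp) auto
    then show ?thesis by (simp add: k_def \<kappa>_def)
  qed
  then have "near_potential k near x \<rho> \<le> ennreal ((unit_ball_vol n + 1) * s powr (1 / p) * 2 powr k * \<rho> powr \<kappa> / (1 - 2 powr (-\<kappa>)))"
    using \<rho> k_pos \<kappa>_pos \<alpha> by (intro near_potential_growth) auto
  then show ?thesis by (simp add: C_near_def mult_ac)
qed

text \<open>The threshold that grows as fast as possible while the shells inside radius \<open>2 R / 2\<^sup>N\<close>
  still contribute at most a multiple of \<open>A\<close>. The powers of \<open>A\<close> and \<open>R\<close> make it scale
  correctly.\<close>

definition "level N = A powr p * (2 * R) powr (n - \<alpha> * p - \<beta>) * 2 powr (real N * \<kappa> * p)"

lemma level_pos: "level N > 0" using A R by (simp add: level_def)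

lemma content_heavy_level:
  "hausdorff_content \<beta> (heavy (level N)) \<le> ennreal (C_heavy * R powr \<beta> * 2 powr (- (\<kappa> * p) * real N))"
proof -
  have "(2 * R) powr (n - \<alpha> * p) = (2 * R) powr (n - \<alpha> * p - \<beta>) * (2 * R) powr \<beta>"
    by (simp add: powr_add[symmetric])
  moreover have "2 powr (- (\<kappa> * p) * real N) * 2 powr (real N * \<kappa> * p) = (1::real)"
    by (simp add: powr_add[symmetric] mult_ac)
  ultimately have "unit_ball_vol \<beta> * 6 powr \<beta> * (Kp * A powr p * (2 * R) powr (n - \<alpha> * p))
     = C_heavy * R powr \<beta> * 2 powr (- (\<kappa> * p) * real N) * level N"
    using R by (simp add: C_heavy_def level_def powr_mult[of 2 R \<beta>])
  then have "unit_ball_vol \<beta> * 6 powr \<beta> * (Kp * A powr p * (2 * R) powr (n - \<alpha> * p)) / level N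
     = C_heavy * R powr \<beta> * 2 powr (- (\<kappa> * p) * real N)"
    using level_pos[of N] by (simp add: field_simps)
  then show ?thesis using content_heavy[OF level_pos, of N] by simp
qed

text \<open>The first \<open>N\<close> shells are estimated at the critical growth, the remaining ones by the
  improved growth that holds off the exceptional set; the powers of \<open>2\<close> and \<open>R\<close> in \<open>level\<close>
  cancel.\<close>

lemma near_potential_level:
  assumes "x \<notin> heavy (level N)"
  shows "near_potential k near x (2 * R) \<le> ennreal ((C_near + 2 powr k * K1) * A * (real N + 1))"
proof -
  have lev: "level N powr (1 / p) = A * (2 * R) powr (-\<kappa>) * 2 powr (real N * \<kappa>)"
  proof -
    have "(n - \<alpha> * p - \<beta>) / p = -\<kappa>" using p by (simp add: \<kappa>_def field_simps)
    then show ?thesis using A R p by (simp add: level_def powr_mult powr_powr)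
  qed
  have "near_potential k near x (2 * R) \<le> near_potential k near x (2 * R / 2 ^ N) + ennreal (real N * (2 powr k * (K1 * A)))"
    using R k_pos K1_pos A by (intro near_potential_shells ball_mass_le near_weak) auto
  also have "near_potential k near x (2 * R / 2 ^ N) \<le> ennreal (C_near * level N powr (1 / p) * (2 * R / 2 ^ N) powr \<kappa>)"
    using R by (intro near_potential_good assms level_pos) auto
  also have "C_near * level N powr (1 / p) * (2 * R / 2 ^ N) powr \<kappa> = C_near * A"
  proof -
    have 1: "(2 * R / 2 ^ N) powr \<kappa> = (2 * R) powr \<kappa> * 2 powr (- (real N * \<kappa>))"
      using R by (subst powr_divide) (simp add: powr_realpow[symmetric] powr_powr powr_minus divide_inverse)
    have 2: "(2 * R) powr (-\<kappa>) * (2 * R) powr \<kappa> = 1" "2 powr (real N * \<kappa>) * 2 powr (- (real N * \<kappa>)) = (1::real)"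
      using R by (simp_all add: powr_add[symmetric])
    have "C_near * level N powr (1 / p) * (2 * R / 2 ^ N) powr \<kappa> =
      C_near * A * ((2 * R) powr (-\<kappa>) * (2 * R) powr \<kappa>) * (2 powr (real N * \<kappa>) * 2 powr (- (real N * \<kappa>)))"
      unfolding 1 lev by (simp only: mult_ac)
    then show ?thesis unfolding 2 by simp
  qed
  also have "ennreal (C_near * A) + ennreal (real N * (2 powr k * (K1 * A))) = ennreal (C_near * A + real N * (2 powr k * (K1 * A)))"
    using C_near_pos A K1_pos by (intro ennreal_plus[symmetric]) auto
  also have "\<dots> \<le> ennreal ((C_near + 2 powr k * K1) * A * (real N + 1))"
  proof (rule ennreal_leI)
    have "(C_near + 2 powr k * K1) * A * (real N + 1) = C_near * A + real N * (2 powr k * (K1 * A)) + (C_near * A * real N + 2 powr k * K1 * A)"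
      by (simp add: algebra_simps)
    moreover have "C_near * A * real N + 2 powr k * K1 * A \<ge> 0" using C_near_pos A K1_pos by auto
    ultimately show "C_near * A + real N * (2 powr k * (K1 * A)) \<le> (C_near + 2 powr k * K1) * A * (real N + 1)" by linarith
  qed
  finally show ?thesis by (simp add: add_right_mono)
qed

lemma riesz_integrand_split:
  "riesz_integrand \<alpha> f x y = near y * norm (x - y) powr (-k) + far y * norm (x - y) powr (-k)"
  by (auto simp: riesz_integrand_def near_def far_def k_def n[symmetric] powr_minus[of "norm (x - y)" "n - \<alpha>", simplified] divide_inverse split: split_indicator)

lemma near_integrable:
  assumes x: "x \<in> ball c (R / 2)" and b: "near_potential k near x (2 * R) \<le> ennreal b" "b \<ge> 0"
  shows "integrable lebesgue (\<lambda>y. near y * norm (x - y) powr (-k))" "\<bar>near_int x\<bar> \<le> b"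
proof -
  have "(\<integral>\<^sup>+y. ennreal \<bar>near y * norm (x - y) powr (-k)\<bar> \<partial>lebesgue) = near_potential k near x (2 * R)"
    unfolding near_potential_def
  proof (intro nn_integral_cong)
    fix y
    have "y \<in> ball x (2 * R)" if "y \<in> cball c R"
    proof -
      have "dist x y \<le> dist x c + dist c y" by (rule dist_triangle)
      also have "\<dots> < 2 * R" using x that R by (auto simp: dist_commute)
      finally show ?thesis by simp
    qed
    then show "ennreal \<bar>near y * norm (x - y) powr (-k)\<bar> = ennreal (\<bar>near y\<bar> * norm (x - y) powr (-k)) * indicator (ball x (2 * R)) y"
      by (cases "y \<in> cball c R") (auto simp: near_def abs_mult)
  qed
  then have *: "(\<integral>\<^sup>+y. ennreal \<bar>near y * norm (x - y) powr (-k)\<bar> \<partial>lebesgue) \<le> ennreal b" using b by simp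
  show "integrable lebesgue (\<lambda>y. near y * norm (x - y) powr (-k))" "\<bar>near_int x\<bar> \<le> b"
    unfolding near_int_def using integrable_of_nn_integral_le[OF _ * b(2)] by auto
qed

lemma far_integrable_of_converges:
  assumes "riesz_converges \<alpha> f z"
  shows "integrable lebesgue (\<lambda>y. far y * norm (z - y) powr (-k))"
proof -
  have "integrable lebesgue (\<lambda>y. indicator (- cball c R) y *\<^sub>R riesz_integrand \<alpha> f z y)"
    using assms by (intro integrable_mult_indicator) (auto simp: riesz_converges_def)
  moreover have "(\<lambda>y. indicator (- cball c R) y *\<^sub>R riesz_integrand \<alpha> f z y) = (\<lambda>y. far y * norm (z - y) powr (-k))"
    by (auto simp: fun_eq_iff riesz_integrand_split far_def near_def split: split_indicator)
  ultimately show ?thesis by simp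
qed

lemma far_lipschitz:
  assumes z: "z \<in> ball c (R / 2)" "integrable lebesgue (\<lambda>y. far y * norm (z - y) powr (-k))"
    and x: "x \<in> ball c (R / 2)"
  shows "integrable lebesgue (\<lambda>y. far y * norm (x - y) powr (-k))"
    and "\<bar>far_int x - far_int z\<bar> \<le> C_far * A * norm (x - z) / R"
proof -
  have "\<And>r. r > 0 \<Longrightarrow> ball_mass f c r \<le> ennreal (K1 * A * r powr k)" by (rule ball_mass_le[OF weak])
  note * = far_potential_lipschitz[OF measurable_f R less_imp_le[OF k_pos] _ this x z(1), folded far_def, OF _ _ z(2)]
  show "integrable lebesgue (\<lambda>y. far y * norm (x - y) powr (-k))" using * K1_pos A by auto
  show "\<bar>far_int x - far_int z\<bar> \<le> C_far * A * norm (x - z) / R"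
    using * K1_pos A unfolding far_int_def by (simp add: C_far_def mult_ac)
qed

lemma riesz_potential_split:
  assumes "integrable lebesgue (\<lambda>y. near y * norm (x - y) powr (-k))" "integrable lebesgue (\<lambda>y. far y * norm (x - y) powr (-k))"
  shows "riesz_converges \<alpha> f x" "riesz_potential \<alpha> f x = (near_int x + far_int x) / riesz_gamma n \<alpha>"
  using assms
  by (simp_all add: riesz_converges_def riesz_potential_def riesz_integrand_split[abs_def] near_int_def far_int_def n[symmetric])

text \<open>The comparison constant is the value of the far part at a point \<open>z\<close> of convergence; the far
  part varies by at most \<open>C_far * A\<close> over the ball, and off the exceptional set the near part
  is at most a multiple of \<open>A (N + 1)\<close>.\<close>

lemma riesz_potential_oscillation:
  assumes z: "z \<in> ball c (R / 2)" "riesz_converges \<alpha> f z" and x: "x \<in> ball c (R / 2)" "x \<notin> heavy (level N)"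
  shows "riesz_converges \<alpha> f x" 
    "\<bar>riesz_potential \<alpha> f x - far_int z / riesz_gamma n \<alpha>\<bar> \<le> C_osc * A * (real N + 1)"
proof -
  have b: "(C_near + 2 powr k * K1) * A * (real N + 1) \<ge> 0" using C_near_pos K1_pos A by auto
  note near = near_integrable[OF x(1) near_potential_level[OF x(2)] b]
  note far = far_lipschitz[OF z(1) far_integrable_of_converges[OF z(2)] x(1)]
  note u = riesz_potential_split[OF near(1) far(1)]
  show "riesz_converges \<alpha> f x" by (rule u)
  have "norm (x - z) \<le> R"
  proof -
    have "dist x z \<le> dist x c + dist c z" by (rule dist_triangle)
    also have "\<dots> \<le> R" using x z by (auto simp: dist_commute)
    finally show ?thesis by (simp add: dist_norm)
  qed
  then have "C_far * A * norm (x - z) / R \<le> C_far * A"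
    using R C_far_pos A by (simp add: divide_le_eq mult_left_mono)
  also have "C_far * A * 1 \<le> C_far * A * (real N + 1)" using C_far_pos A by (intro mult_left_mono) auto
  finally have "\<bar>far_int x - far_int z\<bar> \<le> C_far * A * (real N + 1)" using far(2) by simp
  then have "\<bar>near_int x + far_int x - far_int z\<bar> \<le> (C_near + 2 powr k * K1) * A * (real N + 1) + C_far * A * (real N + 1)"
    using near(2) by linarith
  then have "\<bar>near_int x + far_int x - far_int z\<bar> / riesz_gamma n \<alpha> \<le> ((C_near + 2 powr k * K1) * A * (real N + 1) + C_far * A * (real N + 1)) / riesz_gamma n \<alpha>"
    using riesz_gamma_pos by (intro divide_right_mono) auto
  also have "\<bar>near_int x + far_int x - far_int z\<bar> / riesz_gamma n \<alpha> = \<bar>riesz_potential \<alpha> f x - far_int z / riesz_gamma n \<alpha>\<bar>"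
    using riesz_gamma_pos unfolding u(2) by (simp add: diff_divide_distrib[symmetric])
  also have "((C_near + 2 powr k * K1) * A * (real N + 1) + C_far * A * (real N + 1)) / riesz_gamma n \<alpha> = C_osc * A * (real N + 1)"
    by (simp add: C_osc_def ring_distribs add_divide_distrib)
  finally show "\<bar>riesz_potential \<alpha> f x - far_int z / riesz_gamma n \<alpha>\<bar> \<le> C_osc * A * (real N + 1)" .
qed

text \<open>Off the exceptional set the truncation error is at most a multiple of \<open>\<delta>\<^sup>\<kappa>\<close>, uniformly in
  the point, so the near part is a uniform limit of Lipschitz functions.\<close>

lemma near_int_continuous:
  assumes s: "s > 0"
  shows "continuous_on (ball c (R / 2) - heavy s) near_int"
proof -
  define \<delta> where "\<delta> j = inverse (real (Suc j))" for j
  have \<delta>: "\<delta> j > 0" for j by (simp add: \<delta>_def)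
  define T where "T j x = (\<integral>y. near y * max (norm (x - y)) (\<delta> j) powr (-k) \<partial>lebesgue)" for j x
  define m where "m = K1 * A * (2 * R) powr k"
  have m: "m \<ge> 0" using K1_pos A by (simp add: m_def)
  note T = truncated_potential_lipschitz[OF measurable_near near_total[folded m_def] m \<delta> less_imp_le[OF k_pos]]
  have cont: "continuous_on (ball c (R / 2) - heavy s) (T j)" for j
  proof (rule lipschitz_on_continuous_on)
    show "(k * \<delta> j powr (-k - 1) * m)-lipschitz_on (ball c (R / 2) - heavy s) (T j)"
      using T(2)[of _ j] m k_pos by (intro lipschitz_onI) (auto simp: T_def dist_norm mult_ac)
  qed
  define B where "B = C_near * s powr (1 / p)"
  have B: "B \<ge> 0" using C_near_pos by (simp add: B_def)
  have near: "near_potential k near x \<rho> \<le> ennreal (B * \<rho> powr \<kappa>)" if "x \<notin> heavy s" "\<rho> > 0" for x \<rho>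
    unfolding B_def using near_potential_good that s by auto
  have err: "\<bar>T j x - near_int x\<bar> \<le> B * \<delta> j powr \<kappa>" if x: "x \<in> ball c (R / 2) - heavy s" for x j
    unfolding T_def near_int_def
  proof (rule truncated_potential_error)
    show "near_potential k near x (\<delta> j) \<le> ennreal (B * \<delta> j powr \<kappa>)" using x \<delta> by (intro near) auto
    show "integrable lebesgue (\<lambda>y. near y * norm (x - y) powr (-k))"
      using x R B near[of x "2 * R"] by (intro near_integrable[of x "B * (2 * R) powr \<kappa>"]) auto
    show "integrable lebesgue (\<lambda>y. near y * max (norm (x - y)) (\<delta> j) powr (-k))" by (rule T)
  qed (use k_pos B in auto)
  have lim: "(\<lambda>j. B * \<delta> j powr \<kappa>) \<longlonglongrightarrow> 0"
  proof -
    have "(\<lambda>j. \<delta> j powr \<kappa>) \<longlonglongrightarrow> 0"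
      unfolding \<delta>_def using \<kappa>_pos LIMSEQ_inverse_real_of_nat by (intro tendsto_zero_powrI) auto
    then show ?thesis by (rule tendsto_mult_right_zero)
  qed
  have "uniform_limit (ball c (R / 2) - heavy s) T near_int sequentially"
    unfolding uniform_limit_iff
  proof (intro allI impI)
    fix e :: real assume "e > 0"
    then have "\<forall>\<^sub>F j in sequentially. B * \<delta> j powr \<kappa> < e" using lim by (rule order_tendstoD(2)[rotated])
    then show "\<forall>\<^sub>F j in sequentially. \<forall>x\<in>ball c (R / 2) - heavy s. dist (T j x) (near_int x) < e"
    proof eventually_elim
      case (elim j)
      then show ?case using err[of _ j] by (fastforce simp: dist_real_def)
    qed
  qed
  then show ?thesis using cont by (intro uniform_limit_theorem[where f = T and F = sequentially]) auto
qed

text \<open>Once the far part converges at \<open>z\<close> it converges at every point of the ball, so each of these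
  can take the place of \<open>z\<close> and the oscillation estimate becomes a Lipschitz condition.\<close>

lemma riesz_potential_continuous:
  assumes z: "z \<in> ball c (R / 2)" "riesz_converges \<alpha> f z" and s: "s > 0"
  shows "continuous_on (ball c (R / 2) - heavy s) (riesz_potential \<alpha> f)"
proof -
  have far_integrable: "integrable lebesgue (\<lambda>y. far y * norm (x - y) powr (-k))" if "x \<in> ball c (R / 2)" for x
    by (rule far_lipschitz(1)[OF z(1) far_integrable_of_converges[OF z(2)] that])
  have far: "continuous_on (ball c (R / 2) - heavy s) far_int"
  proof (rule lipschitz_on_continuous_on)
    show "(C_far * A / R)-lipschitz_on (ball c (R / 2) - heavy s) far_int"
    proof (rule lipschitz_onI)
      fix x y assume "x \<in> ball c (R / 2) - heavy s" "y \<in> ball c (R / 2) - heavy s"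
      then have y: "y \<in> ball c (R / 2)" and x: "x \<in> ball c (R / 2)" by auto
      show "dist (far_int x) (far_int y) \<le> C_far * A / R * dist x y"
        using far_lipschitz(2)[OF y far_integrable[OF y] x] by (simp add: dist_norm)
    qed (use C_far_pos A R in auto)
  qed
  have eq: "riesz_potential \<alpha> f x = (near_int x + far_int x) / riesz_gamma n \<alpha>" if x: "x \<in> ball c (R / 2) - heavy s" for x
  proof (rule riesz_potential_split)
    show "integrable lebesgue (\<lambda>y. near y * norm (x - y) powr (-k))"
      using x R C_near_pos s near_potential_good[of x s "2 * R"]
      by (intro near_integrable[of x "C_near * s powr (1 / p) * (2 * R) powr \<kappa>"]) auto
    show "integrable lebesgue (\<lambda>y. far y * norm (x - y) powr (-k))" using far_integrable x by auto
  qed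
  have "continuous_on (ball c (R / 2) - heavy s) (\<lambda>x. (near_int x + far_int x) / riesz_gamma n \<alpha>)"
    using riesz_gamma_pos by (intro continuous_intros near_int_continuous[OF s] far) auto
  then show ?thesis by (rule continuous_on_eq) (simp only: eq)
qed

end

section \<open>Choquet integrals of functions with exponential tails\<close>

lemma nn_integral_exp_tail:
  fixes b E :: real
  assumes "b > 0" "E \<ge> 0"
  shows "(\<integral>\<^sup>+t. ennreal (E * exp (- b * t)) * indicator {0..} t \<partial>lborel) = ennreal (E / b)"
proof -
  have "(\<integral>\<^sup>+t. ennreal (E * exp (- b * t)) * indicator {0..} t \<partial>lborel) = ennreal (0 - (- (E / b) * exp (- b * 0)))"
  proof (rule nn_integral_FTC_atLeast[where F = "\<lambda>t. - (E / b) * exp (- b * t)"])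
    show "((\<lambda>t. - (E / b) * exp (- b * t)) has_real_derivative E * exp (- b * x)) (at x)" for x
      using assms by (auto intro!: derivative_eq_intros)
    have "filterlim (\<lambda>t. - (b * t)) at_bot at_top"
      unfolding filterlim_uminus_at_bot
      using assms by (simp add: filterlim_tendsto_pos_mult_at_top[OF tendsto_const _ filterlim_ident])
    then have "((\<lambda>t. exp (- b * t)) \<longlongrightarrow> 0) at_top"
      by (intro filterlim_compose[OF exp_at_bot]) simp
    then show "((\<lambda>t. - (E / b) * exp (- b * t)) \<longlongrightarrow> 0) at_top"
      by (rule tendsto_mult_right_zero)
  qed (use assms in auto)
  then show ?thesis by simp
qed

lemma choquet_exp_tail:
  fixes g :: "'a::euclidean_space \<Rightarrow> real"
  assumes b: "b > 0" and E: "E \<ge> 0"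
    and tail: "\<And>t. t > 0 \<Longrightarrow> hausdorff_content \<beta> {x \<in> \<Omega>. g x > t} \<le> ennreal (E * exp (- b * t))"
  shows "choquet_integral \<beta> \<Omega> g \<le> ennreal (E / b)"
proof -
  have "choquet_integral \<beta> \<Omega> g \<le> (\<integral>\<^sup>+t. ennreal (E * exp (- b * t)) * indicator {0..} t \<partial>lborel)"
    unfolding choquet_integral_def using tail by (intro nn_integral_mono) (auto split: split_indicator)
  then show ?thesis using nn_integral_exp_tail[OF b E] by simp
qed

text \<open>The rate \<open>b / 2\<close> turns the tail \<open>exp (- b t)\<close> into \<open>t\<close> to the power \<open>-2\<close>, which is
  integrable at infinity; any rate below \<open>b\<close> would do.\<close>

lemma choquet_exp_of_exp_tail:
  fixes g :: "'a::euclidean_space \<Rightarrow> real"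
  assumes b: "b > 0" and E: "E \<ge> 0"
    and tail: "\<And>t. t \<ge> 0 \<Longrightarrow> hausdorff_content \<beta> {x \<in> \<Omega>. g x > t} \<le> ennreal (E * exp (- b * t))"
    and total: "hausdorff_content \<beta> \<Omega> \<le> ennreal E"
  shows "choquet_integral \<beta> \<Omega> (\<lambda>x. exp (b / 2 * g x)) \<le> ennreal (2 * E)"
proof -
  have pow: "(\<integral>\<^sup>+t. ennreal (E * t powr -2) * indicator {1..} t \<partial>lborel) = ennreal E"
  proof -
    have "(\<integral>\<^sup>+t. ennreal (E * t powr -2) * indicator {1..} t \<partial>lborel) = ennreal (0 - (- E * 1 powr -1))"
    proof (rule nn_integral_FTC_atLeast[where F = "\<lambda>t. - E * t powr -1"])
      show "((\<lambda>t. - E * t powr -1) has_real_derivative E * x powr -2) (at x)" if "1 \<le> x" for x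
      proof -
        have "((\<lambda>t. t powr -1) has_real_derivative -1 * x powr (-1 - 1)) (at x)"
          using that by (intro has_real_derivative_powr) auto
        from DERIV_cmult[OF this, of "- E"] show ?thesis by simp
      qed
      have "((\<lambda>t::real. t powr -1) \<longlongrightarrow> 0) at_top"
        by (intro tendsto_neg_powr filterlim_ident) auto
      then show "((\<lambda>t. - E * t powr -1) \<longlongrightarrow> 0) at_top" by (rule tendsto_mult_right_zero)
    qed (use E in auto)
    then show ?thesis by simp
  qed
  have "choquet_integral \<beta> \<Omega> (\<lambda>x. exp (b / 2 * g x)) \<le>
     (\<integral>\<^sup>+t. ennreal E * indicator {0..1} t + ennreal (E * t powr -2) * indicator {1..} t \<partial>lborel)"
    unfolding choquet_integral_def
  proof (intro nn_integral_mono)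
    fix t :: real
    show "hausdorff_content \<beta> {x \<in> \<Omega>. exp (b / 2 * g x) > t} * indicator {0<..} t \<le>
      ennreal E * indicator {0..1} t + ennreal (E * t powr -2) * indicator {1..} t"
    proof (cases "t \<ge> 1")
      case True
      have "{x \<in> \<Omega>. exp (b / 2 * g x) > t} \<subseteq> {x \<in> \<Omega>. g x > 2 * ln t / b}"
      proof safe
        fix x assume "t < exp (b / 2 * g x)"
        then have "ln t < b / 2 * g x" using True by (subst ln_exp[symmetric], subst ln_less_cancel_iff) auto
        then show "2 * ln t / b < g x" using b by (simp add: field_simps)
      qed
      then have "hausdorff_content \<beta> {x \<in> \<Omega>. exp (b / 2 * g x) > t} \<le> hausdorff_content \<beta> {x \<in> \<Omega>. g x > 2 * ln t / b}"
        by (rule hausdorff_content_mono)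
      also have "\<dots> \<le> ennreal (E * exp (- b * (2 * ln t / b)))" using True b by (intro tail) auto
      also have "exp (- b * (2 * ln t / b)) = t powr -2" using True b by (simp add: powr_def)
      finally show ?thesis using True by (simp add: add_increasing)
    next
      case False
      have "hausdorff_content \<beta> {x \<in> \<Omega>. exp (b / 2 * g x) > t} \<le> hausdorff_content \<beta> \<Omega>"
        by (rule hausdorff_content_mono) auto
      also note total
      finally show ?thesis using False by (auto split: split_indicator)
    qed
  qed
  also have "\<dots> = (\<integral>\<^sup>+t. ennreal E * indicator {0..1::real} t \<partial>lborel) + (\<integral>\<^sup>+t. ennreal (E * t powr -2) * indicator {1..} t \<partial>lborel)"
    by (rule nn_integral_add) auto
  also have "(\<integral>\<^sup>+t. ennreal E * indicator {0..1::real} t \<partial>lborel) = ennreal E"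
    by (subst nn_integral_cmult_indicator) auto
  also have "ennreal E + (\<integral>\<^sup>+t. ennreal (E * t powr -2) * indicator {1..} t \<partial>lborel) = ennreal (2 * E)"
    unfolding pow using E by (simp add: ennreal_plus[symmetric] del: ennreal_plus)
  finally show ?thesis .
qed

text \<open>Passing from the thresholds \<open>a (N + 1)\<close> to all real \<open>t\<close> takes the largest such threshold
  that does not exceed \<open>t\<close>. It loses less than two steps, hence the factor \<open>4\<^sup>\<epsilon>\<close>, which also
  covers the values \<open>t < a\<close> by the bound on the total content.\<close>

lemma exp_tail_of_dyadic_tail:
  fixes g :: "'a::euclidean_space \<Rightarrow> real"
  assumes a: "a > 0" and E: "E \<ge> 0" and e: "\<epsilon> > 0"
    and dyadic: "\<And>N::nat. hausdorff_content \<beta> {x \<in> \<Omega>. g x > a * (real N + 1)} \<le> ennreal (E * 2 powr (- \<epsilon> * real N))"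
    and total: "hausdorff_content \<beta> \<Omega> \<le> ennreal E" and t: "t \<ge> 0"
  shows "hausdorff_content \<beta> {x \<in> \<Omega>. g x > t} \<le> ennreal (E * 4 powr \<epsilon> * exp (- (\<epsilon> * ln 2 / a) * t))"
proof -
  have eq: "4 powr \<epsilon> * exp (- (\<epsilon> * ln 2 / a) * t) = 2 powr (\<epsilon> * (2 - t / a))"
  proof -
    have "(4::real) powr \<epsilon> = 2 powr (2 * \<epsilon>)" by (simp add: powr_powr[symmetric])
    also have "\<dots> = exp (2 * \<epsilon> * ln 2)" by (simp add: powr_def)
    finally show ?thesis by (simp add: powr_def exp_add[symmetric] algebra_simps)
  qed
  have "hausdorff_content \<beta> {x \<in> \<Omega>. g x > t} \<le> ennreal (E * 2 powr (\<epsilon> * (2 - t / a)))"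
  proof (cases "t \<ge> a")
    case True
    define N where "N = nat \<lfloor>t / a\<rfloor> - 1"
    have "t / a \<ge> 1" using True a by simp
    then have N: "real N + 1 \<le> t / a" "t / a - 2 \<le> real N" unfolding N_def by linarith+
    have "a * (real N + 1) \<le> t" using N(1) a by (simp add: field_simps)
    then have "hausdorff_content \<beta> {x \<in> \<Omega>. g x > t} \<le> hausdorff_content \<beta> {x \<in> \<Omega>. g x > a * (real N + 1)}"
      by (intro hausdorff_content_mono) auto
    also have "\<dots> \<le> ennreal (E * 2 powr (- \<epsilon> * real N))" by (rule dyadic)
    also have "\<dots> \<le> ennreal (E * 2 powr (\<epsilon> * (2 - t / a)))"
    proof (intro ennreal_leI mult_left_mono powr_mono)
      have "\<epsilon> * (t / a - 2) \<le> \<epsilon> * real N" using N(2) e by (intro mult_left_mono) auto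
      then show "- \<epsilon> * real N \<le> \<epsilon> * (2 - t / a)" by (simp add: algebra_simps)
    qed (use E in auto)
    finally show ?thesis .
  next
    case False
    have "hausdorff_content \<beta> {x \<in> \<Omega>. g x > t} \<le> hausdorff_content \<beta> \<Omega>"
      by (rule hausdorff_content_mono) auto
    also note total
    also have "ennreal E \<le> ennreal (E * 2 powr (\<epsilon> * (2 - t / a)))"
    proof (rule ennreal_leI)
      have "t / a \<le> 2" using False a by (simp add: field_simps)
      then have "1 \<le> (2::real) powr (\<epsilon> * (2 - t / a))" using e by (intro ge_one_powr_ge_zero) auto
      then show "E \<le> E * 2 powr (\<epsilon> * (2 - t / a))" using mult_left_mono[OF _ E, of 1] by simp
    qed
    finally show ?thesis .
  qed
  then show ?thesis by (simp only: eq mult.assoc)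
qed

section \<open>Estimates on cubes\<close>

lemma cube_subset_ball:
  fixes a :: "'a::euclidean_space"
  assumes "l > 0"
  shows "cube a l \<subseteq> ball (a + (l / 2) *\<^sub>R One) (real DIM('a) * l)"
proof
  fix x assume x: "x \<in> cube a l"
  let ?c = "a + (l / 2) *\<^sub>R One"
  have "norm (?c - x) \<le> (\<Sum>i\<in>Basis. \<bar>(?c - x) \<bullet> i\<bar>)" by (rule norm_le_l1)
  also have "\<dots> \<le> (\<Sum>i\<in>(Basis :: 'a set). l / 2)"
  proof (rule sum_mono)
    fix i :: 'a assume i: "i \<in> Basis"
    then have "a \<bullet> i < x \<bullet> i" "x \<bullet> i < a \<bullet> i + l" using x by (auto simp: cube_def mem_box inner_simps)
    moreover have "(?c - x) \<bullet> i = a \<bullet> i + l / 2 - x \<bullet> i" using i by (simp add: inner_simps)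
    ultimately show "\<bar>(?c - x) \<bullet> i\<bar> \<le> l / 2" unfolding abs_le_iff by linarith
  qed
  also have "\<dots> < real DIM('a) * l" using assms DIM_positive[where 'a = 'a] by simp
  finally show "x \<in> ball ?c (real DIM('a) * l)" by (simp add: dist_norm)
qed

lemma AE_lebesgue_obtains_in_ball:
  fixes c :: "'a::euclidean_space"
  assumes "AE x in lebesgue. P x" "r > 0"
  obtains z where "z \<in> ball c r" "P z"
proof (rule ccontr)
  assume "\<not> thesis"
  then have "\<And>z. P z \<Longrightarrow> z \<notin> ball c r" using that by blast
  then have "AE x in lebesgue. x \<notin> ball c r" using assms(1) by (auto elim: eventually_mono)
  then have "ball c r \<in> null_sets lebesgue" by (subst (asm) AE_iff_null_sets[symmetric]) auto
  then have "negligible (ball c r)" by (simp add: negligible_iff_null_sets)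
  then show False using open_not_negligible[of "ball c r"] \<open>r > 0\<close> by auto
qed

context riesz_exponents
begin

text \<open>The two summands bound the content of the exceptional sets and that of the whole cube. The
  tail decays at \<open>rate / A\<close>.\<close>

definition "C_tail = (C_heavy * (2 * n) powr \<beta> + unit_ball_vol \<beta> * n powr \<beta>) * 4 powr (\<kappa> * p)"
definition "rate = \<kappa> * p * ln 2 / C_osc"

lemma C_tail_pos: "C_tail > 0"
  unfolding C_tail_def using C_heavy_pos \<beta> \<alpha> by (intro mult_pos_pos add_pos_nonneg) auto

lemma rate_pos: "rate > 0" unfolding rate_def using \<kappa>_pos p C_osc_pos by (intro divide_pos_pos mult_pos_pos) auto

text \<open>In every ball the divergence set lies in all the exceptional sets, whose contents tend to
  zero.\<close>

lemma riesz_diverges_content_zero: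
  fixes f :: "'a::euclidean_space \<Rightarrow> real"
  assumes n: "n = real DIM('a)" and weak: "weak_bound (n / \<alpha>) A f" and A: "A > 0"
    and conv: "AE x in lebesgue. riesz_converges \<alpha> f x"
  shows "hausdorff_content \<beta> {x. \<not> riesz_converges \<alpha> f x} = 0"
proof -
  have 0: "hausdorff_content \<beta> {x \<in> ball 0 (real (Suc j)). \<not> riesz_converges \<alpha> f x} = 0" for j
  proof -
    interpret L: riesz_local n \<alpha> \<beta> p f A "2 * real (Suc j)" 0
      by unfold_locales (use n weak A in auto)
    obtain z where z: "z \<in> ball (0::'a) (real (Suc j))" "riesz_converges \<alpha> f z"
      using AE_lebesgue_obtains_in_ball[OF conv, of "real (Suc j)" 0] by auto
    define B where "B = C_heavy * (2 * real (Suc j)) powr \<beta>"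
    have le: "hausdorff_content \<beta> {x \<in> ball 0 (real (Suc j)). \<not> riesz_converges \<alpha> f x} \<le> ennreal (B * (2 powr (- (\<kappa> * p))) ^ N)" for N
    proof -
      have "{x \<in> ball 0 (real (Suc j)). \<not> riesz_converges \<alpha> f x} \<subseteq> L.heavy (L.level N)"
      proof safe
        fix x assume x: "x \<in> ball 0 (real (Suc j))" "\<not> riesz_converges \<alpha> f x"
        then show "x \<in> L.heavy (L.level N)"
          using L.riesz_potential_oscillation(1)[of z x N] z by fastforce
      qed
      then have "hausdorff_content \<beta> {x \<in> ball 0 (real (Suc j)). \<not> riesz_converges \<alpha> f x} \<le> hausdorff_content \<beta> (L.heavy (L.level N))"
        by (rule hausdorff_content_mono)
      also have "\<dots> \<le> ennreal (B * 2 powr (- (\<kappa> * p) * real N))"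
        unfolding B_def by (rule L.content_heavy_level)
      also have "2 powr (- (\<kappa> * p) * real N) = (2 powr (- (\<kappa> * p)) :: real) ^ N"
        by (simp add: powr_realpow[symmetric] powr_powr)
      finally show ?thesis .
    qed
    have "(\<lambda>N. B * (2 powr (- (\<kappa> * p))) ^ N) \<longlonglongrightarrow> B * 0"
      using \<kappa>_pos p by (intro tendsto_intros LIMSEQ_power_zero) (auto simp: powr_less_one)
    then have "(\<lambda>N. ennreal (B * (2 powr (- (\<kappa> * p))) ^ N)) \<longlonglongrightarrow> ennreal 0"
      by (intro tendsto_ennrealI) simp
    then have "hausdorff_content \<beta> {x \<in> ball 0 (real (Suc j)). \<not> riesz_converges \<alpha> f x} \<le> ennreal 0"
      by (rule LIMSEQ_le_const) (use le in blast)
    then show ?thesis by simp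
  qed
  have "{x. \<not> riesz_converges \<alpha> f x} \<subseteq> (\<Union>j. {x \<in> ball 0 (real (Suc j)). \<not> riesz_converges \<alpha> f x})"
  proof
    fix x assume x: "x \<in> {x. \<not> riesz_converges \<alpha> f x}"
    obtain j :: nat where "norm x < real j" using reals_Archimedean2 by blast
    then show "x \<in> (\<Union>j. {x \<in> ball 0 (real (Suc j)). \<not> riesz_converges \<alpha> f x})"
      using x by (intro UN_I[of j]) auto
  qed
  then have "hausdorff_content \<beta> {x. \<not> riesz_converges \<alpha> f x} \<le>
      (\<Sum>j. hausdorff_content \<beta> {x \<in> ball 0 (real (Suc j)). \<not> riesz_converges \<alpha> f x})"
    using hausdorff_content_mono hausdorff_content_UN_nat order_trans by blast
  then show ?thesis by (simp only: 0 suminf_zero) simp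
qed

text \<open>The cube lies in the ball of radius \<open>n l\<close> around its centre, so \<open>f\<close> is cut at \<open>R = 2 n l\<close>.
  The constant \<open>v\<close> is the normalised far part at a point of convergence, which exists because
  divergence is confined to a null set. The tail uses the thresholds \<open>level N\<close>; for
  quasicontinuity a single threshold \<open>s\<close> is taken so large that the open exceptional set has
  content below \<open>\<epsilon>\<close>.\<close>

lemma riesz_potential_cube:
  fixes f :: "'a::euclidean_space \<Rightarrow> real"
  assumes n: "n = real DIM('a)" and weak: "weak_bound (n / \<alpha>) A f" and A: "A > 0"
    and conv: "AE x in lebesgue. riesz_converges \<alpha> f x" and l: "l > 0"
  obtains v where
    "\<And>t. t \<ge> 0 \<Longrightarrow> hausdorff_content \<beta> {x \<in> cube a l. \<bar>riesz_potential \<alpha> f x - v\<bar> > t}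
        \<le> ennreal (C_tail * l powr \<beta> * exp (- (rate / A) * t))"
    "hausdorff_content \<beta> (cube a l) \<le> ennreal (C_tail * l powr \<beta>)"
    "quasicontinuous_on \<beta> (cube a l) (riesz_potential \<alpha> f)"
proof -
  define c where "c = a + (l / 2) *\<^sub>R One"
  define R where "R = 2 * (n * l)"
  have R: "R > 0" using l \<alpha> by (simp add: R_def)
  interpret L: riesz_local n \<alpha> \<beta> p f A R c
    by unfold_locales (use n weak A R in auto)
  have Q: "cube a l \<subseteq> ball c (R / 2)" using cube_subset_ball[OF l, of a] by (simp add: c_def R_def n)
  obtain z where z: "z \<in> ball c (R / 2)" "riesz_converges \<alpha> f z"
    using AE_lebesgue_obtains_in_ball[OF conv, of "R / 2" c] R by auto
  define v where "v = L.far_int z / riesz_gamma n \<alpha>"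
  define E where "E = (C_heavy * (2 * n) powr \<beta> + unit_ball_vol \<beta> * n powr \<beta>) * l powr \<beta>"
  have E: "E \<ge> 0" using C_heavy_pos \<beta> by (simp add: E_def unit_ball_vol_nonneg)
  have "hausdorff_content \<beta> (cube a l) \<le> hausdorff_content \<beta> (ball c (R / 2))"
    by (rule hausdorff_content_mono[OF Q])
  also have "\<dots> \<le> ennreal (unit_ball_vol \<beta> * (R / 2) powr \<beta>)" using R by (intro hausdorff_content_ball) auto
  also have "\<dots> \<le> ennreal E"
    using C_heavy_pos l \<alpha> by (intro ennreal_leI) (simp add: E_def R_def powr_mult ring_distribs)
  finally have total: "hausdorff_content \<beta> (cube a l) \<le> ennreal E" .
  have dyadic: "hausdorff_content \<beta> {x \<in> cube a l. \<bar>riesz_potential \<alpha> f x - v\<bar> > C_osc * A * (real N + 1)}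
       \<le> ennreal (E * 2 powr (- (\<kappa> * p) * real N))" for N
  proof -
    have "{x \<in> cube a l. \<bar>riesz_potential \<alpha> f x - v\<bar> > C_osc * A * (real N + 1)} \<subseteq> L.heavy (L.level N)"
      using L.riesz_potential_oscillation(2)[OF z] Q unfolding v_def by force
    then have "hausdorff_content \<beta> {x \<in> cube a l. \<bar>riesz_potential \<alpha> f x - v\<bar> > C_osc * A * (real N + 1)}
        \<le> hausdorff_content \<beta> (L.heavy (L.level N))" by (rule hausdorff_content_mono)
    also have "\<dots> \<le> ennreal (C_heavy * R powr \<beta> * 2 powr (- (\<kappa> * p) * real N))" by (rule L.content_heavy_level)
    also have "\<dots> \<le> ennreal (E * 2 powr (- (\<kappa> * p) * real N))"
    proof (intro ennreal_leI mult_right_mono)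
      have "R powr \<beta> = (2 * n) powr \<beta> * l powr \<beta>" using l \<alpha> by (simp add: R_def powr_mult)
      then show "C_heavy * R powr \<beta> \<le> E" using \<beta> by (simp add: E_def ring_distribs unit_ball_vol_nonneg)
    qed auto
    finally show ?thesis .
  qed
  show thesis
  proof (rule that)
    fix t :: real assume t: "t \<ge> 0"
    have "hausdorff_content \<beta> {x \<in> cube a l. \<bar>riesz_potential \<alpha> f x - v\<bar> > t}
       \<le> ennreal (E * 4 powr (\<kappa> * p) * exp (- ((\<kappa> * p) * ln 2 / (C_osc * A)) * t))"
      using C_osc_pos A \<kappa>_pos p by (intro exp_tail_of_dyadic_tail dyadic total t E) auto
    then show "hausdorff_content \<beta> {x \<in> cube a l. \<bar>riesz_potential \<alpha> f x - v\<bar> > t}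
        \<le> ennreal (C_tail * l powr \<beta> * exp (- (rate / A) * t))"
      by (simp add: E_def C_tail_def rate_def mult_ac)
  next
    have "E * 1 \<le> E * 4 powr (\<kappa> * p)" using E \<kappa>_pos p by (intro mult_left_mono ge_one_powr_ge_zero) auto
    then have "ennreal E \<le> ennreal (C_tail * l powr \<beta>)"
      by (intro ennreal_leI) (simp add: E_def C_tail_def mult_ac)
    with total show "hausdorff_content \<beta> (cube a l) \<le> ennreal (C_tail * l powr \<beta>)" by (rule order_trans)
  next
    show "quasicontinuous_on \<beta> (cube a l) (riesz_potential \<alpha> f)"
      unfolding quasicontinuous_on_def
    proof (intro allI impI)
      fix \<epsilon> :: real assume \<epsilon>: "\<epsilon> > 0"
      define M where "M = unit_ball_vol \<beta> * 6 powr \<beta> * (Kp * A powr p * (2 * R) powr (n - \<alpha> * p))"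
      have M: "M > 0" using \<beta> Kp_pos A R by (simp add: M_def)
      \<comment> \<open>\<open>M / s\<close> bounds the content of the exceptional set.\<close>
      define s where "s = 2 * M / \<epsilon>"
      have s: "s > 0" using M \<epsilon> by (simp add: s_def)
      have "M / s < \<epsilon>" using M \<epsilon> by (simp add: s_def)
      have "hausdorff_content \<beta> (cube a l \<inter> L.heavy s) \<le> hausdorff_content \<beta> (L.heavy s)"
        by (rule hausdorff_content_mono) auto
      also have "\<dots> \<le> ennreal (M / s)" unfolding M_def by (rule L.content_heavy[OF s])
      also have "\<dots> < ennreal \<epsilon>" using \<open>M / s < \<epsilon>\<close> \<epsilon> by (simp add: ennreal_less_iff M s less_imp_le)
      finally have small: "hausdorff_content \<beta> (cube a l \<inter> L.heavy s) < ennreal \<epsilon>" .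
      have "continuous_on (cube a l - cube a l \<inter> L.heavy s) (riesz_potential \<alpha> f)"
        by (rule continuous_on_subset[OF L.riesz_potential_continuous[OF z s]]) (use Q in auto)
      moreover have "open (cube a l \<inter> L.heavy s)" unfolding cube_def by (intro open_Int open_box L.open_heavy)
      ultimately show "\<exists>U. open U \<and> U \<subseteq> cube a l \<and> hausdorff_content \<beta> U < ennreal \<epsilon> \<and> continuous_on (cube a l - U) (riesz_potential \<alpha> f)"
        using small by (intro exI[of _ "cube a l \<inter> L.heavy s"]) auto
    qed
  qed
qed

text \<open>If \<open>|u|\<close> exceeds \<open>t\<close> then \<open>|u - v|\<close> exceeds \<open>t - |v|\<close>. The shift multiplies the tail by \<open>exp
  (b |v|)\<close>, and with this factor the tail also dominates the total content for \<open>t < |v|\<close>.\<close>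

lemma riesz_potential_content_L1_loc:
  fixes f :: "'a::euclidean_space \<Rightarrow> real"
  assumes n: "n = real DIM('a)" and weak: "weak_bound (n / \<alpha>) A f" and A: "A > 0"
    and conv: "AE x in lebesgue. riesz_converges \<alpha> f x"
  shows "riesz_potential \<alpha> f \<in> content_L1_loc \<beta>"
  unfolding content_L1_loc_def content_L1_def
proof (intro CollectI allI impI conjI)
  fix a :: 'a and l :: real assume l: "l > 0"
  obtain v where tail: "\<And>t. t \<ge> 0 \<Longrightarrow> hausdorff_content \<beta> {x \<in> cube a l. \<bar>riesz_potential \<alpha> f x - v\<bar> > t}
        \<le> ennreal (C_tail * l powr \<beta> * exp (- (rate / A) * t))"
    and total: "hausdorff_content \<beta> (cube a l) \<le> ennreal (C_tail * l powr \<beta>)"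
    and qc: "quasicontinuous_on \<beta> (cube a l) (riesz_potential \<alpha> f)"
    using riesz_potential_cube[where a = a, OF assms l] by blast
  show "quasicontinuous_on \<beta> (cube a l) (riesz_potential \<alpha> f)" by (rule qc)
  define E where "E = C_tail * l powr \<beta>"
  define b where "b = rate / A"
  have E: "E \<ge> 0" using C_tail_pos by (simp add: E_def)
  have b: "b > 0" using rate_pos A by (simp add: b_def)
  have "hausdorff_content \<beta> {x \<in> cube a l. \<bar>riesz_potential \<alpha> f x\<bar> > t} \<le> ennreal (E * exp (b * \<bar>v\<bar>) * exp (- b * t))" for t
  proof -
    have eq: "E * exp (b * \<bar>v\<bar>) * exp (- b * t) = E * exp (- b * (t - \<bar>v\<bar>))"
      by (simp add: exp_add[symmetric] algebra_simps)
    show ?thesis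
    proof (cases "t \<ge> \<bar>v\<bar>")
      case True
      have "hausdorff_content \<beta> {x \<in> cube a l. \<bar>riesz_potential \<alpha> f x\<bar> > t} \<le> hausdorff_content \<beta> {x \<in> cube a l. \<bar>riesz_potential \<alpha> f x - v\<bar> > t - \<bar>v\<bar>}"
        by (rule hausdorff_content_mono) auto
      also have "\<dots> \<le> ennreal (E * exp (- b * (t - \<bar>v\<bar>)))" unfolding E_def b_def using True by (intro tail) auto
      finally show ?thesis unfolding eq .
    next
      case False
      have "hausdorff_content \<beta> {x \<in> cube a l. \<bar>riesz_potential \<alpha> f x\<bar> > t} \<le> hausdorff_content \<beta> (cube a l)"
        by (rule hausdorff_content_mono) auto
      also have "\<dots> \<le> ennreal E" unfolding E_def by (rule total)
      also have "\<dots> \<le> ennreal (E * exp (- b * (t - \<bar>v\<bar>)))"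
      proof (rule ennreal_leI)
        have "1 \<le> exp (- b * (t - \<bar>v\<bar>))" using False b by (simp add: mult_le_0_iff)
        then show "E \<le> E * exp (- b * (t - \<bar>v\<bar>))" using mult_left_mono[OF _ E, of 1] by simp
      qed
      finally show ?thesis unfolding eq .
    qed
  qed
  then have "choquet_integral \<beta> (cube a l) (\<lambda>x. \<bar>riesz_potential \<alpha> f x\<bar>) \<le> ennreal (E * exp (b * \<bar>v\<bar>) / b)"
    using E b by (intro choquet_exp_tail) auto
  then show "choquet_integral \<beta> (cube a l) (\<lambda>x. \<bar>riesz_potential \<alpha> f x\<bar>) < \<infinity>"
    using le_less_trans by fastforce
qed

lemma BMO_norm_riesz_potential_le:
  fixes f :: "'a::euclidean_space \<Rightarrow> real"
  assumes n: "n = real DIM('a)" and weak: "weak_bound (n / \<alpha>) A f" and A: "A > 0"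
    and conv: "AE x in lebesgue. riesz_converges \<alpha> f x"
  shows "BMO_norm \<beta> (riesz_potential \<alpha> f) \<le> ennreal (C_tail / rate * A)"
  unfolding BMO_norm_def
proof (rule SUP_least, clarify)
  fix a :: 'a and l :: real assume l: "l > 0"
  obtain v where tail: "\<And>t. t \<ge> 0 \<Longrightarrow> hausdorff_content \<beta> {x \<in> cube a l. \<bar>riesz_potential \<alpha> f x - v\<bar> > t}
        \<le> ennreal (C_tail * l powr \<beta> * exp (- (rate / A) * t))"
    using riesz_potential_cube[where a = a, OF assms l] by blast
  have "choquet_integral \<beta> (cube a l) (\<lambda>x. \<bar>riesz_potential \<alpha> f x - v\<bar>) \<le> ennreal (C_tail * l powr \<beta> / (rate / A))"
    using tail rate_pos A C_tail_pos by (intro choquet_exp_tail) auto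
  then have "ennreal (1 / l powr \<beta>) * choquet_integral \<beta> (cube a l) (\<lambda>x. \<bar>riesz_potential \<alpha> f x - v\<bar>)
     \<le> ennreal (1 / l powr \<beta>) * ennreal (C_tail * l powr \<beta> / (rate / A))"
    by (intro mult_left_mono) auto
  also have "\<dots> = ennreal (1 / l powr \<beta> * (C_tail * l powr \<beta> / (rate / A)))"
    using C_tail_pos rate_pos A by (intro ennreal_mult[symmetric]) auto
  also have "1 / l powr \<beta> * (C_tail * l powr \<beta> / (rate / A)) = C_tail / rate * A" using l by simp
  finally show "(INF c. ennreal (1 / l powr \<beta>) * choquet_integral \<beta> (cube a l) (\<lambda>x. \<bar>riesz_potential \<alpha> f x - c\<bar>))
      \<le> ennreal (C_tail / rate * A)"
    by (rule INF_lower2[OF UNIV_I])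
qed

lemma riesz_potential_exp_integrable:
  fixes f :: "'a::euclidean_space \<Rightarrow> real"
  assumes n: "n = real DIM('a)" and weak: "weak_bound (n / \<alpha>) A f" and A: "A > 0"
    and conv: "AE x in lebesgue. riesz_converges \<alpha> f x" and l: "l > 0"
  shows "\<exists>v. choquet_integral \<beta> (cube a l) (\<lambda>x. exp (rate / 2 * \<bar>riesz_potential \<alpha> f x - v\<bar> / A))
      \<le> ennreal (2 * C_tail * l powr \<beta>)"
proof -
  obtain v where tail: "\<And>t. t \<ge> 0 \<Longrightarrow> hausdorff_content \<beta> {x \<in> cube a l. \<bar>riesz_potential \<alpha> f x - v\<bar> > t}
        \<le> ennreal (C_tail * l powr \<beta> * exp (- (rate / A) * t))"
    and total: "hausdorff_content \<beta> (cube a l) \<le> ennreal (C_tail * l powr \<beta>)"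
    using riesz_potential_cube[where a = a, OF assms] by blast
  have "choquet_integral \<beta> (cube a l) (\<lambda>x. exp (rate / A / 2 * \<bar>riesz_potential \<alpha> f x - v\<bar>)) \<le> ennreal (2 * (C_tail * l powr \<beta>))"
    using tail total rate_pos A C_tail_pos by (intro choquet_exp_of_exp_tail) auto
  then show ?thesis by (intro exI[of _ v]) (simp add: mult_ac)
qed

end

theorem theorem1p5:
  fixes \<alpha> \<beta> :: real
  assumes "0 < \<alpha>" and "\<alpha> < real CARD('n::finite)"
    and "0 < \<beta>" and "\<beta> \<le> real CARD('n)"
  shows
    "(\<exists>C>0. \<forall>f :: real ^ 'n \<Rightarrow> real.
        f \<in> weak_Lp (real CARD('n) / \<alpha>) \<and> riesz_potential_L1_loc \<alpha> f \<longrightarrow>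
          hausdorff_content \<beta> {x. \<not> riesz_converges \<alpha> f x} = 0 \<and>
          riesz_potential \<alpha> f \<in> BMO \<beta> \<and>
          BMO_norm \<beta> (riesz_potential \<alpha> f) \<le> ennreal C * weak_Lp_norm (real CARD('n) / \<alpha>) f)
     \<and>
     (\<exists>\<gamma>>0. \<exists>C\<^sub>0>0. \<forall>f :: real ^ 'n \<Rightarrow> real.
        f \<in> weak_Lp (real CARD('n) / \<alpha>) \<and> riesz_potential_L1_loc \<alpha> f \<and>
        \<not> (AE x in lebesgue. f x = 0) \<longrightarrow>
          (\<forall>a l. l > 0 \<longrightarrow>
            (\<exists>c::real. choquet_integral \<beta> (cube a l)
                (\<lambda>x. exp (\<gamma> * \<bar>riesz_potential \<alpha> f x - c\<bar>
                       / enn2real (weak_Lp_norm (real CARD('n) / \<alpha>) f)))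
              \<le> ennreal (C\<^sub>0 * l powr \<beta>))))"
proof -
  define n where "n = real CARD('n)"
  define q where "q = n / \<alpha>"
  have q: "q > 0" using assms by (simp add: q_def n_def)
  define m where "m = max 1 ((n - \<beta>) / \<alpha>)"
  \<comment> \<open>The midpoint of the window of admissible exponents, nonempty because \<open>\<beta> > 0\<close> and \<open>\<alpha> < n\<close>.\<close>
  define p where "p = (m + q) / 2"
  have m: "1 \<le> m" "(n - \<beta>) / \<alpha> \<le> m" by (auto simp: m_def)
  have "m < q" using assms by (auto simp: m_def n_def q_def field_simps)
  then have "m < p" "p < q" by (auto simp: p_def)
  with m have "1 \<le> p" "(n - \<beta>) / \<alpha> < p" "p < n / \<alpha>" by (auto simp: q_def)
  then have p: "1 \<le> p" "n - \<beta> < \<alpha> * p" "\<alpha> * p < n" using assms(1) by (auto simp: field_simps)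
  interpret E: riesz_exponents n \<alpha> \<beta> p
    by unfold_locales (use assms p in \<open>auto simp: n_def\<close>)
  have dim: "n = real DIM(real ^ 'n)" by (simp add: n_def)
  define C where "C = E.C_tail / E.rate"
  have C: "C > 0" using E.C_tail_pos E.rate_pos by (simp add: C_def)
  show ?thesis
    unfolding n_def[symmetric] q_def[symmetric]
  proof (rule conjI, goal_cases)
    case 1
    show ?case
    proof (rule exI[of _ C], rule conjI[OF C], intro conjI allI impI)
      fix f :: "real ^ 'n \<Rightarrow> real"
      assume f: "f \<in> weak_Lp q \<and> riesz_potential_L1_loc \<alpha> f"
      have fm: "f \<in> borel_measurable lebesgue" and fin: "weak_Lp_norm q f < \<infinity>"
        and conv: "AE x in lebesgue. riesz_converges \<alpha> f x"
        using f by (auto simp: weak_Lp_def riesz_potential_L1_loc_def)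
      obtain w where w: "weak_Lp_norm q f = ennreal w" "w \<ge> 0" using fin by (cases "weak_Lp_norm q f") auto
      have wb: "weak_bound (n / \<alpha>) A f" if "w \<le> A" "A > 0" for A
        unfolding q_def[symmetric] using that w by (intro weak_boundI fm q) (auto intro: ennreal_leI)
      \<comment> \<open>The quasi-norm \<open>w\<close> may be \<open>0\<close>, so a positive bound is needed; the slack disappears in the limit \<open>e \<rightarrow> 0\<close>.\<close>
      have wb1: "weak_bound (n / \<alpha>) (w + 1) f" using w by (intro wb) auto
      have w1: "w + 1 > 0" using w by simp
      show "hausdorff_content \<beta> {x. \<not> riesz_converges \<alpha> f x} = 0"
        by (rule E.riesz_diverges_content_zero[OF dim wb1 w1 conv])
      show le: "BMO_norm \<beta> (riesz_potential \<alpha> f) \<le> ennreal C * weak_Lp_norm q f"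
      proof (rule ennreal_le_epsilon)
        fix e :: real assume e: "0 < e"
        have "BMO_norm \<beta> (riesz_potential \<alpha> f) \<le> ennreal (C * (w + e / C))"
          unfolding C_def[symmetric] using e C w
          by (intro E.BMO_norm_riesz_potential_le[OF dim wb _ conv, folded C_def]) (auto intro: add_nonneg_pos)
        also have "C * (w + e / C) = C * w + e" using C by (simp add: field_simps)
        also have "ennreal (C * w + e) = ennreal C * weak_Lp_norm q f + ennreal e"
          using C e w by (simp add: ennreal_mult)
        finally show "BMO_norm \<beta> (riesz_potential \<alpha> f) \<le> ennreal C * weak_Lp_norm q f + ennreal e" .
      qed
      have "ennreal C * weak_Lp_norm q f < \<infinity>" using fin by (simp add: ennreal_mult_less_top)
      with le have "BMO_norm \<beta> (riesz_potential \<alpha> f) < \<infinity>" by (rule le_less_trans)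
      then show "riesz_potential \<alpha> f \<in> BMO \<beta>"
        using E.riesz_potential_content_L1_loc[OF dim wb1 w1 conv] by (simp add: BMO_def)
    qed
  next
    case 2
    have pos: "E.rate / 2 > 0" "2 * E.C_tail > 0" using E.rate_pos E.C_tail_pos by auto
    show ?case
    proof (rule exI[of _ "E.rate / 2"], rule conjI[OF pos(1)], rule exI[of _ "2 * E.C_tail"],
        rule conjI[OF pos(2)], intro allI impI)
      fix f :: "real ^ 'n \<Rightarrow> real" and a :: "real ^ 'n" and l :: real
      assume f: "f \<in> weak_Lp q \<and> riesz_potential_L1_loc \<alpha> f \<and> \<not> (AE x in lebesgue. f x = 0)" and l: "0 < l"
      have fm: "f \<in> borel_measurable lebesgue" and fin: "weak_Lp_norm q f < \<infinity>"
        and conv: "AE x in lebesgue. riesz_converges \<alpha> f x" and nz: "weak_Lp_norm q f \<noteq> 0"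
        using f weak_Lp_norm_eq_0_imp_AE[of f q] by (auto simp: weak_Lp_def riesz_potential_L1_loc_def)
      obtain w where w: "weak_Lp_norm q f = ennreal w" "w \<ge> 0" using fin by (cases "weak_Lp_norm q f") auto
      have wpos: "w > 0" using w nz by (cases "w = 0") auto
      have wb: "weak_bound (n / \<alpha>) w f"
        unfolding q_def[symmetric] using w by (intro weak_boundI fm q wpos) auto
      show "\<exists>c::real. choquet_integral \<beta> (cube a l)
            (\<lambda>x. exp (E.rate / 2 * \<bar>riesz_potential \<alpha> f x - c\<bar> / enn2real (weak_Lp_norm q f)))
          \<le> ennreal (2 * E.C_tail * l powr \<beta>)"
        using E.riesz_potential_exp_integrable[OF dim wb wpos conv l] w by simp
    qed
  qed
qed

end
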